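(* The \textsc{Weighted Treedepth} problem can be solved in polynomial time on $1$-subdivided stars; that is, given a $1$-subdivided star $G$ with weight function $w\colon V(G)\to\mathbb{N}$, a treedepth decomposition of $G$ of minimum weighted depth (and hence $\mathrm{wtd}(G)$) can be computed in polynomial time.
   Context: $\mathbb{N}$ denotes the positive integers. A $1$-subdivided star is the graph obtained from a star $S_n$ (a central vertex adjacent to $n$ leaves) by replacing each edge by a path of length $2$; i.e.\ it has a central vertex $a$, neighbours $b_1,\dots,b_n$ of $a$, and for each $i$ a vertex $c_i$ adjacent only to $b_i$. A treedepth decomposition of a graph $G$ is a rooted forest $F$ with $V(F)=V(G)$ such that for every edge $uv\in E(G)$, $u$ is an ancestor of $v$ in $F$ or $v$ is an ancestor of $u$ in $F$. The weighted depth of a treedepth decomposition is the maximum, over all root-to-leaf paths, of the sum of the weights of the vertices on the path; $\mathrm{wtd}(G)$ is the minimum weighted depth over all treedepth decompositions of $G$. The \textsc{Weighted Treedepth} problem asks, given $G$, $w$ and an integer $k$, whether $\mathrm{wtd}(G)\le k$. Weights are assumed polynomially bounded in the number of vertices. *)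

theory Defs
  imports Main "HOL-Library.Log_Nat" "HOL-Computational_Algebra.Polynomial"
begin

section \<open>Weighted treedepth\<close>

text \<open>A graph is given by its vertex set and its set of (two-element) edges, a rooted forest by its
  parent map, which sends the roots to \<^term>\<open>None\<close>.\<close>

definition subdivided_star :: "'a set \<Rightarrow> 'a set set \<Rightarrow> bool" where
  "subdivided_star V E \<longleftrightarrow>
     (\<exists>(m::nat) a b c. m \<ge> 1 \<and>
        inj_on b {1..m} \<and> inj_on c {1..m} \<and>
        a \<notin> b ` {1..m} \<and> a \<notin> c ` {1..m} \<and> b ` {1..m} \<inter> c ` {1..m} = {} \<and>
        V = {a} \<union> b ` {1..m} \<union> c ` {1..m} \<and>
        E = (\<lambda>i. {a, b i}) ` {1..m} \<union> (\<lambda>i. {b i, c i}) ` {1..m})"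

definition parent_rel :: "('a \<Rightarrow> 'a option) \<Rightarrow> ('a \<times> 'a) set" where
  "parent_rel F = {(u, v). F v = Some u}"

definition rooted_forest :: "'a set \<Rightarrow> ('a \<Rightarrow> 'a option) \<Rightarrow> bool" where
  "rooted_forest V F \<longleftrightarrow> finite V \<and> dom F \<subseteq> V \<and> ran F \<subseteq> V \<and> acyclic (parent_rel F)"

definition treedepth_decomposition :: "'a set \<Rightarrow> 'a set set \<Rightarrow> ('a \<Rightarrow> 'a option) \<Rightarrow> bool" where
  "treedepth_decomposition V E F \<longleftrightarrow> rooted_forest V F \<and>
     (\<forall>u v. {u, v} \<in> E \<longrightarrow> (u, v) \<in> (parent_rel F)\<^sup>+ \<or> (v, u) \<in> (parent_rel F)\<^sup>+)"

definition root_to_leaf_path :: "'a set \<Rightarrow> ('a \<Rightarrow> 'a option) \<Rightarrow> 'a list \<Rightarrow> bool" where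
  "root_to_leaf_path V F xs \<longleftrightarrow> xs \<noteq> [] \<and> set xs \<subseteq> V \<and> F (hd xs) = None \<and>
     successively (\<lambda>u v. F v = Some u) xs \<and> last xs \<notin> ran F"

definition weighted_depth :: "'a set \<Rightarrow> ('a \<Rightarrow> nat) \<Rightarrow> ('a \<Rightarrow> 'a option) \<Rightarrow> nat" where
  "weighted_depth V w F = Max {sum_list (map w xs) | xs. root_to_leaf_path V F xs}"

definition wtd :: "'a set \<Rightarrow> 'a set set \<Rightarrow> ('a \<Rightarrow> nat) \<Rightarrow> nat" where
  "wtd V E w = (LEAST d. \<exists>F. treedepth_decomposition V E F \<and> weighted_depth V w F = d)"


section \<open>Random access machines and polynomial time\<close>

text \<open>A random access machine with registers and an indirectly addressed memory, both holding natural
  numbers. Every instruction costs one step. As addition and (truncated) subtraction are the only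
  arithmetic operations, numbers grow by at most one bit per step, so that polynomial time in this
  unit-cost model coincides with polynomial time on Turing machines.\<close>

datatype instr =
    Const nat nat      \<comment> \<open>\<open>R[r] := k\<close>\<close>
  | Add nat nat nat    \<comment> \<open>\<open>R[r] := R[s] + R[t]\<close>\<close>
  | Sub nat nat nat    \<comment> \<open>\<open>R[r] := R[s] - R[t]\<close>, truncated at \<open>0\<close>\<close>
  | Load nat nat       \<comment> \<open>\<open>R[r] := M[R[s]]\<close>\<close>
  | Store nat nat      \<comment> \<open>\<open>M[R[r]] := R[s]\<close>\<close>
  | JumpZero nat nat   \<comment> \<open>if \<open>R[r] = 0\<close> go to instruction number \<open>l\<close>\<close>

type_synonym program = "instr list"

text \<open>Program counter, registers, memory.\<close>
type_synonym config = "nat \<times> (nat \<Rightarrow> nat) \<times> (nat \<Rightarrow> nat)"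

fun exec_instr :: "instr \<Rightarrow> config \<Rightarrow> config" where
  "exec_instr (Const r k) (pc, R, M) = (Suc pc, R(r := k), M)"
| "exec_instr (Add r s t) (pc, R, M) = (Suc pc, R(r := R s + R t), M)"
| "exec_instr (Sub r s t) (pc, R, M) = (Suc pc, R(r := R s - R t), M)"
| "exec_instr (Load r s) (pc, R, M) = (Suc pc, R(r := M (R s)), M)"
| "exec_instr (Store r s) (pc, R, M) = (Suc pc, R, M(R r := R s))"
| "exec_instr (JumpZero r l) (pc, R, M) = (if R r = 0 then l else Suc pc, R, M)"

text \<open>The machine halts by leaving the program text.\<close>

definition halted :: "program \<Rightarrow> config \<Rightarrow> bool" where
  "halted P cf \<longleftrightarrow> fst cf \<ge> length P"

definition step :: "program \<Rightarrow> config \<Rightarrow> config" where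
  "step P cf = (if halted P cf then cf else exec_instr (P ! fst cf) cf)"

text \<open>The input is stored in memory from address \<open>0\<close> on; everything else is initially \<open>0\<close>.\<close>

definition init_config :: "nat list \<Rightarrow> config" where
  "init_config xs = (0, (\<lambda>_. 0), (\<lambda>i. if i < length xs then xs ! i else 0))"

text \<open>Size of an input in bits; the successor accounts for a separator after each number.\<close>

definition input_size :: "nat list \<Rightarrow> nat" where
  "input_size xs = (\<Sum>x\<leftarrow>xs. Suc (nat (bitlen (int x))))"

text \<open>\<open>P\<close> solves a problem on the set \<open>D\<close> of instances, encoded by \<open>enc\<close>, if on every instance
  \<open>x\<close> it halts, within a number of steps polynomial in the size of the input, with a memory that is
  a correct answer for \<open>x\<close> according to \<open>Q x\<close>.\<close>

definition solves_in_polytime ::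
    "program \<Rightarrow> 'x set \<Rightarrow> ('x \<Rightarrow> nat list) \<Rightarrow> ('x \<Rightarrow> (nat \<Rightarrow> nat) \<Rightarrow> bool) \<Rightarrow> bool" where
  "solves_in_polytime P D enc Q \<longleftrightarrow>
     (\<exists>p :: nat poly. \<forall>x\<in>D. \<exists>t \<le> poly p (input_size (enc x)). \<exists>pc R M.
        (step P ^^ t) (init_config (enc x)) = (pc, R, M) \<and> halted P (pc, R, M) \<and> Q x M)"


section \<open>The problems to be solved\<close>

text \<open>An instance \<open>(n, E, w)\<close> is a graph on the vertices \<open>0, \<dots>, n - 1\<close> with vertex weights \<open>w\<close>.
  It is given to the machine as \<open>n\<close>, the list of weights, and the adjacency matrix row by row.
  An integer is given as its sign bit and its absolute value.\<close>

type_synonym weighted_graph = "nat \<times> nat set set \<times> (nat \<Rightarrow> nat)"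

fun encode_graph :: "weighted_graph \<Rightarrow> nat list" where
  "encode_graph (n, E, w) =
     n # map w [0..<n] @ concat (map (\<lambda>i. map (\<lambda>j. if {i, j} \<in> E then 1 else 0) [0..<n]) [0..<n])"

fun encode_graph_int :: "weighted_graph \<times> int \<Rightarrow> nat list" where
  "encode_graph_int (G, k) = encode_graph G @ [if k < 0 then 1 else 0, nat \<bar>k\<bar>]"

text \<open>Weights are positive and bounded by the polynomial \<open>q\<close> in the number of vertices.\<close>

definition star_instances :: "nat poly \<Rightarrow> weighted_graph set" where
  "star_instances q =
     {(n, E, w). subdivided_star {..<n} E \<and> (\<forall>v<n. 1 \<le> w v \<and> w v \<le> poly q n)}"

text \<open>A forest is returned as a parent array starting at address \<open>1\<close>: the entry of \<open>v\<close> is \<open>0\<close>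
  if \<open>v\<close> is a root, and \<open>u + 1\<close> if its parent is \<open>u\<close>. The weighted depth is at address \<open>0\<close>.\<close>

definition decode_forest :: "nat \<Rightarrow> (nat \<Rightarrow> nat) \<Rightarrow> nat \<Rightarrow> nat option" where
  "decode_forest n M v = (if v < n \<and> M (Suc v) \<noteq> 0 then Some (M (Suc v) - 1) else None)"

fun optimal_decomposition_output :: "weighted_graph \<Rightarrow> (nat \<Rightarrow> nat) \<Rightarrow> bool" where
  "optimal_decomposition_output (n, E, w) M \<longleftrightarrow>
     treedepth_decomposition {..<n} E (decode_forest n M) \<and>
     weighted_depth {..<n} w (decode_forest n M) = wtd {..<n} E w \<and>
     M 0 = wtd {..<n} E w"

fun weighted_treedepth_output :: "weighted_graph \<times> int \<Rightarrow> (nat \<Rightarrow> nat) \<Rightarrow> bool" where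
  "weighted_treedepth_output ((n, E, w), k) M \<longleftrightarrow>
     M 0 = (if int (wtd {..<n} E w) \<le> k then 1 else 0)"

end

theory Submission imports Defs begin

text \<open>In a treedepth decomposition of a subdivided star with centre \<open>a\<close>, let \<open>S\<close> be the set of middle
  vertices above \<open>a\<close>. Only the largest weight \<open>t\<close> of a pendant path \<open>b c\<close> with \<open>b\<close> outside \<open>S\<close>
  matters, and shrinking \<open>S\<close> never increases the depth otherwise, so one may take \<open>S\<close> to be the set
  of all \<open>b\<close> with \<open>w b + w c > t\<close>. Ordering \<open>S\<close> is scheduling with delivery times, which Jackson's
  rule solves: place the vertices of \<open>S\<close> by decreasing weight of their leaves. Hence it suffices to
  compare one decomposition for every possible threshold \<open>t\<close>. Each of them is given by an explicit
  ancestor relation, from which depths and parents are read off by sums over all vertices; such sums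
  are evaluated by nested loops of length \<open>n\<close>, whose nesting depth is fixed.\<close>

section \<open>Bounded loops on the random access machine\<close>

text \<open>No given decomposition is ever rearranged. Instead, for an arbitrary decomposition G,
  each root path of the explicit forest is bounded by the weight of one chain of G. For b in S, the
  vertices placed up to b form a chain in G; the lowest of them has, by the ordering, a leaf at
  least as heavy as that of b, and in G this leaf lies on a common chain with all of them.
  Thresholds come from vertices (the weight of a pendant path, or 0 when no middle vertex stays
  below the centre), so there are at most n candidates, whatever the size of the weights. The
  running time is therefore polynomial in n alone, and a single program serves every weight bound q.
  The machine has neither recursion nor multiplication; describing forests by ancestor relations
  leaves only sums, maxima and searches over the vertices.\<close>

text \<open>Variable \<open>0\<close> holds the number of vertices and bounds every loop. \<open>Loop x e f\<close> starts the
  accumulator \<open>x\<close> with \<open>e\<close> and repeatedly assigns \<open>f\<close> to it, with the loop index in variable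
  \<open>x + 1\<close>. Bound variables are de Bruijn levels: they have to be numbered by their nesting depth.\<close>

datatype exp =
    Var nat
  | Num nat
  | Plus exp exp
  | Minus exp exp
  | Mem exp
  | Ifz exp exp exp
  | Bind nat exp exp
  | Loop nat exp exp

primrec eval :: "exp \<Rightarrow> (nat \<Rightarrow> nat) \<Rightarrow> (nat \<Rightarrow> nat) \<Rightarrow> nat" where
  "eval (Var i) \<rho> M = \<rho> i"
| "eval (Num c) \<rho> M = c"
| "eval (Plus e f) \<rho> M = eval e \<rho> M + eval f \<rho> M"
| "eval (Minus e f) \<rho> M = eval e \<rho> M - eval f \<rho> M"
| "eval (Mem e) \<rho> M = M (eval e \<rho> M)"
| "eval (Ifz b e f) \<rho> M = (if eval b \<rho> M = 0 then eval e \<rho> M else eval f \<rho> M)"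
| "eval (Bind x e f) \<rho> M = eval f (\<rho>(x := eval e \<rho> M)) M"
| "eval (Loop x e f) \<rho> M =
     fold (\<lambda>i s. eval f (\<rho>(x := s, Suc x := i)) M) [0..<\<rho> 0] (eval e \<rho> M)"

text \<open>\<open>d\<close> counts the variables in scope. Forcing a binder to be \<open>d\<close>
  makes its register fresh, so that compiled code never overwrites an outer variable;
  \<open>Loop\<close> takes two levels, for accumulator and index.\<close>

primrec wf_exp :: "nat \<Rightarrow> exp \<Rightarrow> bool" where
  "wf_exp d (Var i) \<longleftrightarrow> i < d"
| "wf_exp d (Num c) \<longleftrightarrow> True"
| "wf_exp d (Plus e f) \<longleftrightarrow> wf_exp d e \<and> wf_exp d f"
| "wf_exp d (Minus e f) \<longleftrightarrow> wf_exp d e \<and> wf_exp d f"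
| "wf_exp d (Mem e) \<longleftrightarrow> wf_exp d e"
| "wf_exp d (Ifz b e f) \<longleftrightarrow> wf_exp d b \<and> wf_exp d e \<and> wf_exp d f"
| "wf_exp d (Bind x e f) \<longleftrightarrow> x = d \<and> wf_exp d e \<and> wf_exp (Suc x) f"
| "wf_exp d (Loop x e f) \<longleftrightarrow> x = d \<and> wf_exp d e \<and> wf_exp (Suc (Suc x)) f"

text \<open>Only commands write to memory, so evaluating an expression cannot damage the encoding of
  the graph.\<close>

datatype cmd = Write exp exp | Seq cmd cmd | For nat cmd

primrec run :: "cmd \<Rightarrow> (nat \<Rightarrow> nat) \<Rightarrow> (nat \<Rightarrow> nat) \<Rightarrow> (nat \<Rightarrow> nat)" where
  "run (Write e f) \<rho> M = M(eval e \<rho> M := eval f \<rho> M)"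
| "run (Seq b c) \<rho> M = run c \<rho> (run b \<rho> M)"
| "run (For x c) \<rho> M = fold (\<lambda>i. run c (\<rho>(x := i))) [0..<\<rho> 0] M"

primrec wf_cmd :: "nat \<Rightarrow> cmd \<Rightarrow> bool" where
  "wf_cmd d (Write e f) \<longleftrightarrow> wf_exp d e \<and> wf_exp d f"
| "wf_cmd d (Seq b c) \<longleftrightarrow> wf_cmd d b \<and> wf_cmd d c"
| "wf_cmd d (For x c) \<longleftrightarrow> x = d \<and> wf_cmd (Suc x) c"

text \<open>After compiled code has run, registers of variables from \<open>d\<close> on may hold
  leftovers; these do not affect the value. Variable 0 has to be in scope because every
  \<open>Loop\<close> reads its bound there.\<close>

lemma eval_cong:
  "wf_exp d e \<Longrightarrow> 0 < d \<Longrightarrow> (\<And>i. i < d \<Longrightarrow> \<rho> i = \<rho>' i) \<Longrightarrow> eval e \<rho> M = eval e \<rho>' M"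
proof (induction e arbitrary: d \<rho> \<rho>')
  case (Bind x e f)
  have "eval e \<rho> M = eval e \<rho>' M"
    using Bind.prems by (intro Bind.IH(1)[of d]) auto
  moreover have "eval f (\<rho>(x := v)) M = eval f (\<rho>'(x := v)) M" for v
    using Bind.prems by (intro Bind.IH(2)[of "Suc d"]) (auto simp: less_Suc_eq)
  ultimately show ?case by simp
next
  case (Loop x e f)
  have "eval e \<rho> M = eval e \<rho>' M"
    using Loop.prems by (intro Loop.IH(1)[of d]) auto
  moreover have "eval f (\<rho>(x := s, Suc x := i)) M = eval f (\<rho>'(x := s, Suc x := i)) M" for s i
    using Loop.prems by (intro Loop.IH(2)[of "Suc (Suc d)"]) (auto simp: less_Suc_eq)
  ultimately show ?case using Loop.prems by simp
next
  case (Ifz b e f)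
  have "eval b \<rho> M = eval b \<rho>' M" "eval e \<rho> M = eval e \<rho>' M" "eval f \<rho> M = eval f \<rho>' M"
    using Ifz.prems Ifz.IH[of d \<rho> \<rho>'] by simp_all
  then show ?case by simp
next
  case (Plus e f)
  have "eval e \<rho> M = eval e \<rho>' M" "eval f \<rho> M = eval f \<rho>' M"
    using Plus.prems Plus.IH[of d \<rho> \<rho>'] by simp_all
  then show ?case by simp
next
  case (Minus e f)
  have "eval e \<rho> M = eval e \<rho>' M" "eval f \<rho> M = eval f \<rho>' M"
    using Minus.prems Minus.IH[of d \<rho> \<rho>'] by simp_all
  then show ?case by simp
next
  case (Mem e)
  have "eval e \<rho> M = eval e \<rho>' M"
    using Mem.prems by (intro Mem.IH[of d]) auto
  then show ?case by simp
qed auto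

lemma run_cong:
  "wf_cmd d c \<Longrightarrow> 0 < d \<Longrightarrow> (\<And>i. i < d \<Longrightarrow> \<rho> i = \<rho>' i) \<Longrightarrow> run c \<rho> M = run c \<rho>' M"
proof (induction c arbitrary: d \<rho> \<rho>' M)
  case (Write e f)
  then show ?case using eval_cong[of d _ \<rho> \<rho>'] by simp
next
  case (Seq b c)
  have "run b \<rho> M = run b \<rho>' M" "\<And>M. run c \<rho> M = run c \<rho>' M"
    using Seq.prems Seq.IH[of d \<rho> \<rho>'] by simp_all
  then show ?case by simp
next
  case (For x c)
  have "run c (\<rho>(x := i)) = run c (\<rho>'(x := i))" for i
    using For.prems by (intro ext For.IH[of "Suc d"]) (auto simp: less_Suc_eq)
  then show ?case using For.prems by simp
qed

section \<open>Timed executions of program fragments\<close>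

definition reaches :: "program \<Rightarrow> nat \<Rightarrow> config \<Rightarrow> config \<Rightarrow> bool" where
  "reaches P t cf cf' \<longleftrightarrow> (\<exists>s\<le>t. (step P ^^ s) cf = cf')"

lemma reaches_refl: "reaches P t cf cf"
  unfolding reaches_def by (rule exI[of _ 0]) simp

lemma reaches_mono: "reaches P s cf cf' \<Longrightarrow> s \<le> t \<Longrightarrow> reaches P t cf cf'"
  unfolding reaches_def using le_trans by blast

lemma reaches_trans:
  assumes "reaches P s cf cf'" "reaches P t cf' cf''"
  shows "reaches P (s + t) cf cf''"
proof -
  obtain i j where "i \<le> s" "(step P ^^ i) cf = cf'" "j \<le> t" "(step P ^^ j) cf' = cf''"
    using assms unfolding reaches_def by blast
  then have "(step P ^^ (j + i)) cf = cf'' \<and> j + i \<le> s + t"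
    by (simp add: funpow_add)
  then show ?thesis unfolding reaches_def by blast
qed

text \<open>Jump targets are absolute, so a fragment is always considered at its place inside the
  whole program.\<close>

definition code_at :: "program \<Rightarrow> nat \<Rightarrow> program \<Rightarrow> bool" where
  "code_at P p xs \<longleftrightarrow> (\<exists>pre post. P = pre @ xs @ post \<and> length pre = p)"

lemma code_at_append:
  "code_at P p (xs @ ys) \<longleftrightarrow> code_at P p xs \<and> code_at P (p + length xs) ys"
proof
  assume "code_at P p (xs @ ys)"
  then obtain pre post where *: "P = pre @ (xs @ ys) @ post" "length pre = p"
    unfolding code_at_def by blast
  have "P = pre @ xs @ (ys @ post)" "P = (pre @ xs) @ ys @ post"
    "length (pre @ xs) = p + length xs"
    using * by auto
  then show "code_at P p xs \<and> code_at P (p + length xs) ys"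
    using *(2) unfolding code_at_def by blast
next
  assume "code_at P p xs \<and> code_at P (p + length xs) ys"
  then obtain pre post pre' post' where *: "P = pre @ xs @ post" "length pre = p"
    "P = pre' @ ys @ post'" "length pre' = p + length xs"
    unfolding code_at_def by blast
  then have "pre' = pre @ xs"
    by (metis append.assoc append_eq_append_conv length_append)
  then have "P = pre @ (xs @ ys) @ post'" using *(3) by simp
  then show "code_at P p (xs @ ys)"
    using *(2) unfolding code_at_def by blast
qed

lemma code_at_Cons:
  "code_at P p (c # xs) \<longleftrightarrow> code_at P p [c] \<and> code_at P (Suc p) xs"
  using code_at_append[of P p "[c]" xs] by simp

lemma step_code_at: "code_at P p [c] \<Longrightarrow> step P (p, R, M) = exec_instr c (p, R, M)"
  by (auto simp: code_at_def step_def halted_def nth_append)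

lemma reaches_exec:
  assumes "code_at P p [c]" "reaches P t (exec_instr c (p, R, M)) cf"
  shows "reaches P (Suc t) (p, R, M) cf"
proof -
  have "reaches P 1 (p, R, M) (exec_instr c (p, R, M))"
    unfolding reaches_def by (rule exI[of _ 1]) (simp add: step_code_at[OF assms(1)])
  from reaches_trans[OF this assms(2)] show ?thesis by simp
qed

section \<open>Machine code for copies, loops, expressions and commands\<close>

definition var_reg :: "nat \<Rightarrow> nat" where "var_reg i = 2 * i"
definition tmp_reg :: "nat \<Rightarrow> nat" where "tmp_reg k = Suc (2 * k)"

lemma reg_simps [simp]:
  "var_reg i = var_reg j \<longleftrightarrow> i = j" "tmp_reg i = tmp_reg j \<longleftrightarrow> i = j" "var_reg i \<noteq> tmp_reg k" "tmp_reg k \<noteq> var_reg i"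
  unfolding var_reg_def tmp_reg_def by presburger+

text \<open>A copy is an addition of zero, the zero being put into \<open>tmp_reg k\<close>. The
  source must differ from that register, while the target may coincide with it.\<close>

definition move :: "nat \<Rightarrow> nat \<Rightarrow> nat \<Rightarrow> program" where
  "move k r s = [Const (tmp_reg k) 0, Add r s (tmp_reg k)]"

lemma length_move [simp]: "length (move k r s) = 2"
  by (simp add: move_def)

lemma reaches_move:
  assumes "code_at P p (move k r s)" "s \<noteq> tmp_reg k"
  shows "reaches P 2 (p, R, M) (p + 2, R(tmp_reg k := 0, r := R s), M)"
proof -
  have c: "code_at P p [Const (tmp_reg k) 0]" "code_at P (Suc p) [Add r s (tmp_reg k)]"
    using assms(1) unfolding move_def by (simp_all add: code_at_Cons[of P _ _ "[_]"])
  have "reaches P (Suc (Suc 0)) (p, R, M) (p + 2, R(tmp_reg k := 0, r := R s), M)"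
    by (intro reaches_exec[OF c(1)], simp, intro reaches_exec[OF c(2)])
       (use assms(2) in \<open>auto intro: reaches_refl\<close>)
  then show ?thesis by (simp add: numeral_2_eq_2)
qed

text \<open>The truncated difference of bound and counter vanishes exactly when the loop is over.
  The jump back is a \<open>JumpZero\<close> on a register just cleared. Two instructions before the
  body and four after it give the offset 6.\<close>

definition loop :: "nat \<Rightarrow> nat \<Rightarrow> nat \<Rightarrow> program \<Rightarrow> program" where
  "loop p k y body =
     Sub (tmp_reg k) (var_reg 0) (var_reg y) # JumpZero (tmp_reg k) (p + length body + 6) # body @
     [Const (tmp_reg k) 1, Add (var_reg y) (var_reg y) (tmp_reg k), Const (tmp_reg k) 0, JumpZero (tmp_reg k) p]"

lemma length_loop [simp]: "length (loop p k y body) = length body + 6"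
  by (simp add: loop_def)

text \<open>\<open>stable\<close> keeps the invariant independent of the counter and the scratch
  register, which the loop control overwrites. A round costs six instructions besides the body, the
  final test two; \<open>0 < y\<close> keeps the counter apart from the bound in variable 0.\<close>

lemma reaches_loop:
  assumes code: "code_at P p (loop p k y body)" and y: "0 < y"
    and body: "\<And>i R M. I i R M \<Longrightarrow> i < N \<Longrightarrow> R (var_reg y) = i \<Longrightarrow> R (var_reg 0) = N \<Longrightarrow>
      \<exists>R' M'. reaches P B (p + 2, R, M) (p + 2 + length body, R', M') \<and> I (Suc i) R' M' \<and>
        R' (var_reg y) = i \<and> R' (var_reg 0) = N"
    and stable: "\<And>i R M z. I i R M \<Longrightarrow> I i (R(tmp_reg k := z)) M" "\<And>i R M z. I i R M \<Longrightarrow> I i (R(var_reg y := z)) M"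
    and init: "I 0 R M" "R (var_reg y) = 0" "R (var_reg 0) = N"
  shows "\<exists>R' M'. reaches P (N * (B + 6) + 2) (p, R, M) (p + length body + 6, R', M') \<and>
    I N R' M' \<and> R' (var_reg 0) = N"
proof -
  let ?q = "p + 2 + length body"
  have c: "code_at P p [Sub (tmp_reg k) (var_reg 0) (var_reg y)]"
      "code_at P (Suc p) [JumpZero (tmp_reg k) (p + length body + 6)]"
      "code_at P ?q [Const (tmp_reg k) 1]" "code_at P (Suc ?q) [Add (var_reg y) (var_reg y) (tmp_reg k)]"
      "code_at P (Suc (Suc ?q)) [Const (tmp_reg k) 0]" "code_at P (Suc (Suc (Suc ?q))) [JumpZero (tmp_reg k) p]"
    using code unfolding loop_def
    by (simp_all add: code_at_Cons[of P _ _ "_ # _"] code_at_Cons[of P _ _ "_ @ _"] code_at_append)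
  have "\<exists>R' M'. reaches P ((N - i) * (B + 6) + 2) (p, R, M) (p + length body + 6, R', M') \<and>
      I N R' M' \<and> R' (var_reg 0) = N"
    if "i \<le> N" "I i R M" "R (var_reg y) = i" "R (var_reg 0) = N" for i R M
    using that
  proof (induction "N - i" arbitrary: i R M)
    case 0
    have "reaches P (Suc (Suc 0)) (p, R, M) (p + length body + 6, R(tmp_reg k := 0), M)"
      by (intro reaches_exec[OF c(1)], simp, intro reaches_exec[OF c(2)])
         (use 0 in \<open>auto intro: reaches_refl\<close>)
    moreover have "N = i" using 0 by simp
    moreover have "I i (R(tmp_reg k := 0)) M" "(R(tmp_reg k := 0)) (var_reg 0) = N"
      using stable(1) 0 by auto
    ultimately show ?case by (metis add_2_eq_Suc' add.commute diff_self_eq_0 mult_0)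
  next
    case (Suc m)
    define R1 where "R1 = R(tmp_reg k := N - i)"
    have r1: "reaches P (Suc (Suc 0)) (p, R, M) (p + 2, R1, M)"
      by (intro reaches_exec[OF c(1)], simp, intro reaches_exec[OF c(2)])
         (use Suc in \<open>auto intro: reaches_refl simp: R1_def\<close>)
    obtain R2 M2 where R2: "reaches P B (p + 2, R1, M) (?q, R2, M2)"
      "I (Suc i) R2 M2" "R2 (var_reg y) = i" "R2 (var_reg 0) = N"
      using body[of i R1 M] stable(1)[OF Suc(4)] Suc by (force simp: R1_def)
    define R3 where "R3 = R2(tmp_reg k := 1, var_reg y := Suc i, tmp_reg k := 0)"
    have r3: "reaches P (Suc (Suc (Suc (Suc 0)))) (?q, R2, M2) (p, R3, M2)"
      by (intro reaches_exec[OF c(3)], simp only: exec_instr.simps, intro reaches_exec[OF c(4)],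
          simp only: exec_instr.simps, intro reaches_exec[OF c(5)], simp only: exec_instr.simps,
          intro reaches_exec[OF c(6)])
         (use R2(3) in \<open>auto intro: reaches_refl simp: R3_def\<close>)
    obtain R' M' where r4: "reaches P ((N - Suc i) * (B + 6) + 2) (p, R3, M2)
        (p + length body + 6, R', M')" "I N R' M'" "R' (var_reg 0) = N"
    proof -
      have "I (Suc i) R3 M2" unfolding R3_def by (intro stable R2)
      moreover have "R3 (var_reg y) = Suc i" "R3 (var_reg 0) = N"
        using R2 y by (auto simp: R3_def)
      moreover have "m = N - Suc i" "Suc i \<le> N" using Suc.hyps(2) by linarith+
      ultimately show ?thesis using Suc.hyps(1)[of "Suc i" R3 M2] that by blast
    qed
    have r5: "reaches P (Suc (Suc 0) + (B + (Suc (Suc (Suc (Suc 0))) + ((N - Suc i) * (B + 6) + 2))))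
        (p, R, M) (p + length body + 6, R', M')"
      by (rule reaches_trans[OF r1 reaches_trans[OF R2(1) reaches_trans[OF r3 r4(1)]]])
    have m: "N - Suc i = m" "N - i = Suc m" using Suc.hyps(2) by linarith+
    have "reaches P ((N - i) * (B + 6) + 2) (p, R, M) (p + length body + 6, R', M')"
      by (rule reaches_mono[OF r5]) (simp add: m algebra_simps)
    then show ?case using \<open>I N R' M'\<close> \<open>R' (var_reg 0) = N\<close> by blast
  qed
  from this[of 0] init show ?thesis by simp
qed

text \<open>\<open>p\<close> is the address of the code, needed for absolute jumps; the result goes
  to \<open>tmp_reg k\<close>, and lower temporaries hold pending operands. In \<open>Ifz\<close>
  the branch for zero comes last, at \<open>q\<close>: the 3 counts the jump into it and the two
  instructions that skip it, which clear \<open>tmp_reg (Suc k)\<close> to spare the result.\<close>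

fun compile :: "nat \<Rightarrow> nat \<Rightarrow> exp \<Rightarrow> program" where
  "compile p k (Var i) = move k (tmp_reg k) (var_reg i)"
| "compile p k (Num c) = [Const (tmp_reg k) c]"
| "compile p k (Plus e f) =
     (let E = compile p k e; F = compile (p + length E) (Suc k) f
      in E @ F @ [Add (tmp_reg k) (tmp_reg k) (tmp_reg (Suc k))])"
| "compile p k (Minus e f) =
     (let E = compile p k e; F = compile (p + length E) (Suc k) f
      in E @ F @ [Sub (tmp_reg k) (tmp_reg k) (tmp_reg (Suc k))])"
| "compile p k (Mem e) = compile p k e @ [Load (tmp_reg k) (tmp_reg k)]"
| "compile p k (Ifz b e f) =
     (let B = compile p k b;
          F = compile (p + length B + 1) k f;
          q = p + length B + length F + 3;
          E = compile q k e
      in B @ [JumpZero (tmp_reg k) q] @ F @ [Const (tmp_reg (Suc k)) 0, JumpZero (tmp_reg (Suc k)) (q + length E)] @ E)"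
| "compile p k (Bind x e f) =
     (let E = compile p k e @ move (Suc k) (var_reg x) (tmp_reg k) in E @ compile (p + length E) k f)"
| "compile p k (Loop x e f) =
     (let E = compile p k e @ move (Suc k) (var_reg x) (tmp_reg k) @ [Const (var_reg (Suc x)) 0];
          q = p + length E
      in E @ loop q k (Suc x) (compile (q + 2) k f @ move (Suc k) (var_reg x) (tmp_reg k)) @ move k (tmp_reg k) (var_reg x))"

text \<open>Polynomials in the value of variable 0. \<open>Ifz\<close> charges both branches, which
  is sound because \<open>reaches\<close> bounds the number of steps from above. In
  \<open>Loop\<close>, 8 is six for control and two for storing the accumulator; 7 is two for its
  initialisation, one for the counter, two for the last test and two for fetching the
  result.\<close>

primrec cost :: "exp \<Rightarrow> nat poly" where
  "cost (Var i) = 2"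
| "cost (Num c) = 1"
| "cost (Plus e f) = cost e + cost f + 1"
| "cost (Minus e f) = cost e + cost f + 1"
| "cost (Mem e) = cost e + 1"
| "cost (Ifz b e f) = cost b + cost e + cost f + 3"
| "cost (Bind x e f) = cost e + cost f + 2"
| "cost (Loop x e f) = cost e + [:0, 1:] * (cost f + 8) + 7"

text \<open>The two preservation clauses carry the induction: a first operand in
  \<open>tmp_reg k\<close> survives the second one, compiled with \<open>Suc k\<close>, and
  variables in scope survive for whatever is evaluated later.\<close>

lemma reaches_compile:
  assumes "code_at P p (compile p k e)" "wf_exp d e" "0 < d"
  shows "\<exists>R'. reaches P (poly (cost e) (R (var_reg 0))) (p, R, M) (p + length (compile p k e), R', M) \<and>
    R' (tmp_reg k) = eval e (\<lambda>i. R (var_reg i)) M \<and> (\<forall>i<d. R' (var_reg i) = R (var_reg i)) \<and> (\<forall>j<k. R' (tmp_reg j) = R (tmp_reg j))"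
  using assms
proof (induction p k e arbitrary: d R rule: compile.induct)
  case (1 p k i)
  define R1 where "R1 = R(tmp_reg k := 0, tmp_reg k := R (var_reg i))"
  have "reaches P 2 (p, R, M) (p + 2, R1, M)"
    unfolding R1_def using 1 by (intro reaches_move) auto
  then show ?case by (intro exI[of _ R1]) (simp, simp add: R1_def)
next
  case (2 p k c)
  define R1 where "R1 = R(tmp_reg k := c)"
  have "reaches P (Suc 0) (p, R, M) (p + 1, R1, M)"
    unfolding R1_def
    by (intro reaches_exec[of P p "Const (tmp_reg k) c"]) (use 2 in \<open>auto intro: reaches_refl\<close>)
  then show ?case by (intro exI[of _ R1]) (simp, simp add: R1_def)
next
  case (3 p k e f)
  have wf: "wf_exp d e" "wf_exp d f" and pos: "0 < d" using 3 by simp_all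
  define E where "E = compile p k e"
  define F where "F = compile (p + length E) (Suc k) f"
  have c: "code_at P p E" "code_at P (p + length E) F"
    "code_at P (p + length E + length F) [Add (tmp_reg k) (tmp_reg k) (tmp_reg (Suc k))]"
    using 3(3) unfolding compile.simps Let_def E_def[symmetric] F_def[symmetric]
    by (simp_all add: code_at_append add.assoc)
  obtain R1 where R1: "reaches P (poly (cost e) (R (var_reg 0))) (p, R, M) (p + length E, R1, M)"
    "R1 (tmp_reg k) = eval e (\<lambda>i. R (var_reg i)) M" "\<forall>i<d. R1 (var_reg i) = R (var_reg i)" "\<forall>j<k. R1 (tmp_reg j) = R (tmp_reg j)"
    using 3(1)[OF c(1)[unfolded E_def] wf(1) pos, of R, folded E_def] by blast
  obtain R2 where R2: "reaches P (poly (cost f) (R1 (var_reg 0))) (p + length E, R1, M)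
      (p + length E + length F, R2, M)"
    "R2 (tmp_reg (Suc k)) = eval f (\<lambda>i. R1 (var_reg i)) M" "\<forall>i<d. R2 (var_reg i) = R1 (var_reg i)"
    "\<forall>j<Suc k. R2 (tmp_reg j) = R1 (tmp_reg j)"
    using 3(2)[OF E_def c(2)[unfolded F_def] wf(2) pos, of R1, folded F_def] by blast
  define R3 where "R3 = R2(tmp_reg k := R2 (tmp_reg k) + R2 (tmp_reg (Suc k)))"
  have "reaches P 1 (p + length E + length F, R2, M) (p + length E + length F + 1, R3, M)"
    unfolding R3_def One_nat_def by (intro reaches_exec[OF c(3)]) (auto intro: reaches_refl)
  from reaches_trans[OF R1(1) reaches_trans[OF R2(1) this]]
  moreover have "R1 (var_reg 0) = R (var_reg 0)" using R1(3) pos by blast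
  ultimately have "reaches P (poly (cost (Plus e f)) (R (var_reg 0))) (p, R, M)
      (p + length (compile p k (Plus e f)), R3, M)"
    by (simp add: Let_def E_def F_def add.assoc)
  moreover have "eval f (\<lambda>i. R1 (var_reg i)) M = eval f (\<lambda>i. R (var_reg i)) M"
    using R1(3) wf pos by (intro eval_cong[of d]) auto
  then have "R3 (tmp_reg k) = eval (Plus e f) (\<lambda>i. R (var_reg i)) M"
    using R1(2) R2(2,4) by (simp add: R3_def)
  moreover have "\<forall>i<d. R3 (var_reg i) = R (var_reg i)" "\<forall>j<k. R3 (tmp_reg j) = R (tmp_reg j)"
    using R1(3,4) R2(3,4) by (simp_all add: R3_def)
  ultimately show ?case by blast
next
  case (4 p k e f)
  have wf: "wf_exp d e" "wf_exp d f" and pos: "0 < d" using 4 by simp_all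
  define E where "E = compile p k e"
  define F where "F = compile (p + length E) (Suc k) f"
  have c: "code_at P p E" "code_at P (p + length E) F"
    "code_at P (p + length E + length F) [Sub (tmp_reg k) (tmp_reg k) (tmp_reg (Suc k))]"
    using 4(3) unfolding compile.simps Let_def E_def[symmetric] F_def[symmetric]
    by (simp_all add: code_at_append add.assoc)
  obtain R1 where R1: "reaches P (poly (cost e) (R (var_reg 0))) (p, R, M) (p + length E, R1, M)"
    "R1 (tmp_reg k) = eval e (\<lambda>i. R (var_reg i)) M" "\<forall>i<d. R1 (var_reg i) = R (var_reg i)" "\<forall>j<k. R1 (tmp_reg j) = R (tmp_reg j)"
    using 4(1)[OF c(1)[unfolded E_def] wf(1) pos, of R, folded E_def] by blast
  obtain R2 where R2: "reaches P (poly (cost f) (R1 (var_reg 0))) (p + length E, R1, M)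
      (p + length E + length F, R2, M)"
    "R2 (tmp_reg (Suc k)) = eval f (\<lambda>i. R1 (var_reg i)) M" "\<forall>i<d. R2 (var_reg i) = R1 (var_reg i)"
    "\<forall>j<Suc k. R2 (tmp_reg j) = R1 (tmp_reg j)"
    using 4(2)[OF E_def c(2)[unfolded F_def] wf(2) pos, of R1, folded F_def] by blast
  define R3 where "R3 = R2(tmp_reg k := R2 (tmp_reg k) - R2 (tmp_reg (Suc k)))"
  have "reaches P 1 (p + length E + length F, R2, M) (p + length E + length F + 1, R3, M)"
    unfolding R3_def One_nat_def by (intro reaches_exec[OF c(3)]) (auto intro: reaches_refl)
  from reaches_trans[OF R1(1) reaches_trans[OF R2(1) this]]
  moreover have "R1 (var_reg 0) = R (var_reg 0)" using R1(3) pos by blast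
  ultimately have "reaches P (poly (cost (Minus e f)) (R (var_reg 0))) (p, R, M)
      (p + length (compile p k (Minus e f)), R3, M)"
    by (simp add: Let_def E_def F_def add.assoc)
  moreover have "eval f (\<lambda>i. R1 (var_reg i)) M = eval f (\<lambda>i. R (var_reg i)) M"
    using R1(3) wf pos by (intro eval_cong[of d]) auto
  then have "R3 (tmp_reg k) = eval (Minus e f) (\<lambda>i. R (var_reg i)) M"
    using R1(2) R2(2,4) by (simp add: R3_def)
  moreover have "\<forall>i<d. R3 (var_reg i) = R (var_reg i)" "\<forall>j<k. R3 (tmp_reg j) = R (tmp_reg j)"
    using R1(3,4) R2(3,4) by (simp_all add: R3_def)
  ultimately show ?case by blast
next
  case (5 p k e)
  define E where "E = compile p k e"
  have c: "code_at P p E" "code_at P (p + length E) [Load (tmp_reg k) (tmp_reg k)]"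
    using 5(2) unfolding compile.simps E_def[symmetric] by (simp_all add: code_at_append)
  obtain R1 where R1: "reaches P (poly (cost e) (R (var_reg 0))) (p, R, M) (p + length E, R1, M)"
    "R1 (tmp_reg k) = eval e (\<lambda>i. R (var_reg i)) M" "\<forall>i<d. R1 (var_reg i) = R (var_reg i)" "\<forall>j<k. R1 (tmp_reg j) = R (tmp_reg j)"
    using 5(1)[OF c(1)[unfolded E_def], of d R, folded E_def] 5(3,4) by auto
  define R2 where "R2 = R1(tmp_reg k := M (R1 (tmp_reg k)))"
  have "reaches P 1 (p + length E, R1, M) (p + length E + 1, R2, M)"
    unfolding R2_def One_nat_def by (intro reaches_exec[OF c(2)]) (auto intro: reaches_refl)
  from reaches_trans[OF R1(1) this]
  have "reaches P (poly (cost (Mem e)) (R (var_reg 0))) (p, R, M) (p + length (compile p k (Mem e)), R2, M)"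
    by (simp add: E_def add.assoc)
  moreover have "R2 (tmp_reg k) = eval (Mem e) (\<lambda>i. R (var_reg i)) M"
    "\<forall>i<d. R2 (var_reg i) = R (var_reg i)" "\<forall>j<k. R2 (tmp_reg j) = R (tmp_reg j)"
    using R1(2-4) by (simp_all add: R2_def)
  ultimately show ?case by blast
next
  case (6 p k b e f)
  have wf: "wf_exp d b" "wf_exp d e" "wf_exp d f" and pos: "0 < d" using 6 by simp_all
  define B where "B = compile p k b"
  define F where "F = compile (p + length B + 1) k f"
  define q where "q = p + length B + length F + 3"
  define E where "E = compile q k e"
  have code_eq: "compile p k (Ifz b e f) =
      B @ [JumpZero (tmp_reg k) q] @ F @ [Const (tmp_reg (Suc k)) 0, JumpZero (tmp_reg (Suc k)) (q + length E)] @ E"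
    by (simp add: Let_def B_def F_def q_def E_def)
  have c: "code_at P p B" "code_at P (p + length B) [JumpZero (tmp_reg k) q]"
    "code_at P (p + length B + 1) F" "code_at P (p + length B + 1 + length F) [Const (tmp_reg (Suc k)) 0]"
    "code_at P (Suc (p + length B + 1 + length F)) [JumpZero (tmp_reg (Suc k)) (q + length E)]"
    "code_at P q E"
    using 6(4) unfolding code_eq
    by (simp_all add: code_at_append code_at_Cons[of P _ _ "_ @ _"] code_at_Cons[of P _ _ "_ # _"]
      code_at_Cons[of P _ _ E] q_def add.assoc numeral_3_eq_3)
  obtain R1 where R1: "reaches P (poly (cost b) (R (var_reg 0))) (p, R, M) (p + length B, R1, M)"
    "R1 (tmp_reg k) = eval b (\<lambda>i. R (var_reg i)) M" "\<forall>i<d. R1 (var_reg i) = R (var_reg i)" "\<forall>j<k. R1 (tmp_reg j) = R (tmp_reg j)"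
    using 6(1)[OF c(1)[unfolded B_def] wf(1) pos, of R, folded B_def] by blast
  have R10: "R1 (var_reg 0) = R (var_reg 0)" using R1(3) pos by blast
  have ev: "eval e (\<lambda>i. R1 (var_reg i)) M = eval e (\<lambda>i. R (var_reg i)) M"
    "eval f (\<lambda>i. R1 (var_reg i)) M = eval f (\<lambda>i. R (var_reg i)) M"
    using R1(3) eval_cong[OF wf(2) pos, of "\<lambda>i. R1 (var_reg i)" "\<lambda>i. R (var_reg i)"]
      eval_cong[OF wf(3) pos, of "\<lambda>i. R1 (var_reg i)" "\<lambda>i. R (var_reg i)"] by simp_all
  have len: "p + length (compile p k (Ifz b e f)) = q + length E"
    unfolding code_eq q_def by simp
  show ?case
  proof (cases "R1 (tmp_reg k) = 0")
    case True
    have "reaches P 1 (p + length B, R1, M) (q, R1, M)"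
      unfolding One_nat_def by (intro reaches_exec[OF c(2)]) (use True in \<open>auto intro: reaches_refl\<close>)
    moreover obtain R2 where R2: "reaches P (poly (cost e) (R1 (var_reg 0))) (q, R1, M) (q + length E, R2, M)"
      "R2 (tmp_reg k) = eval e (\<lambda>i. R1 (var_reg i)) M" "\<forall>i<d. R2 (var_reg i) = R1 (var_reg i)" "\<forall>j<k. R2 (tmp_reg j) = R1 (tmp_reg j)"
      using 6(3)[OF B_def F_def q_def c(6)[unfolded E_def] wf(2) pos, of R1, folded E_def] by blast
    ultimately have "reaches P (poly (cost b) (R (var_reg 0)) + (1 + poly (cost e) (R1 (var_reg 0)))) (p, R, M)
        (q + length E, R2, M)"
      by (intro reaches_trans[OF R1(1)] reaches_trans)
    then have "reaches P (poly (cost (Ifz b e f)) (R (var_reg 0))) (p, R, M) (q + length E, R2, M)"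
      by (rule reaches_mono) (use R10 in simp)
    moreover have "R2 (tmp_reg k) = eval (Ifz b e f) (\<lambda>i. R (var_reg i)) M"
      "\<forall>i<d. R2 (var_reg i) = R (var_reg i)" "\<forall>j<k. R2 (tmp_reg j) = R (tmp_reg j)"
      using R1(2-4) R2(2-4) True ev by simp_all
    ultimately show ?thesis unfolding len by blast
  next
    case False
    have "reaches P 1 (p + length B, R1, M) (p + length B + 1, R1, M)"
      unfolding One_nat_def by (intro reaches_exec[OF c(2)]) (use False in \<open>auto intro: reaches_refl\<close>)
    moreover obtain R2 where R2: "reaches P (poly (cost f) (R1 (var_reg 0))) (p + length B + 1, R1, M)
        (p + length B + 1 + length F, R2, M)"
      "R2 (tmp_reg k) = eval f (\<lambda>i. R1 (var_reg i)) M" "\<forall>i<d. R2 (var_reg i) = R1 (var_reg i)" "\<forall>j<k. R2 (tmp_reg j) = R1 (tmp_reg j)"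
      using 6(2)[OF B_def c(3)[unfolded F_def] wf(3) pos, of R1, folded F_def] by blast
    moreover have "reaches P (Suc (Suc 0)) (p + length B + 1 + length F, R2, M)
        (q + length E, R2(tmp_reg (Suc k) := 0), M)"
      by (intro reaches_exec[OF c(4)], simp only: exec_instr.simps, intro reaches_exec[OF c(5)])
        (auto intro: reaches_refl)
    ultimately have "reaches P (poly (cost b) (R (var_reg 0)) + (1 + (poly (cost f) (R1 (var_reg 0)) + Suc (Suc 0))))
        (p, R, M) (q + length E, R2(tmp_reg (Suc k) := 0), M)"
      by (intro reaches_trans[OF R1(1)] reaches_trans)
    then have "reaches P (poly (cost (Ifz b e f)) (R (var_reg 0))) (p, R, M)
        (q + length E, R2(tmp_reg (Suc k) := 0), M)"
      by (rule reaches_mono) (use R10 in simp)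
    moreover have "(R2(tmp_reg (Suc k) := 0)) (tmp_reg k) = eval (Ifz b e f) (\<lambda>i. R (var_reg i)) M"
      "\<forall>i<d. (R2(tmp_reg (Suc k) := 0)) (var_reg i) = R (var_reg i)" "\<forall>j<k. (R2(tmp_reg (Suc k) := 0)) (tmp_reg j) = R (tmp_reg j)"
      using R1(2-4) R2(2-4) False ev by simp_all
    ultimately show ?thesis unfolding len by blast
  qed
next
  case (7 p k x e f)
  define E where "E = compile p k e"
  define F where "F = compile (p + length E + 2) k f"
  have code_eq: "compile p k (Bind x e f) = E @ move (Suc k) (var_reg x) (tmp_reg k) @ F"
    by (simp add: Let_def E_def F_def)
  have c: "code_at P p E" "code_at P (p + length E) (move (Suc k) (var_reg x) (tmp_reg k))"
    "code_at P (p + length E + 2) F"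
    using 7(3) unfolding code_eq by (simp_all add: code_at_append)
  have x: "x = d" and wf: "wf_exp d e" "wf_exp (Suc d) f" and pos: "0 < d" using 7 by auto
  obtain R1 where R1: "reaches P (poly (cost e) (R (var_reg 0))) (p, R, M) (p + length E, R1, M)"
    "R1 (tmp_reg k) = eval e (\<lambda>i. R (var_reg i)) M" "\<forall>i<d. R1 (var_reg i) = R (var_reg i)" "\<forall>j<k. R1 (tmp_reg j) = R (tmp_reg j)"
    using 7(1)[OF c(1)[unfolded E_def] wf(1) pos, of R, folded E_def] by blast
  define R2 where "R2 = R1(tmp_reg (Suc k) := 0, var_reg x := R1 (tmp_reg k))"
  have "reaches P 2 (p + length E, R1, M) (p + length E + 2, R2, M)"
    unfolding R2_def by (intro reaches_move[OF c(2)]) simp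
  moreover obtain R3 where R3: "reaches P (poly (cost f) (R2 (var_reg 0))) (p + length E + 2, R2, M)
      (p + length E + 2 + length F, R3, M)"
    "R3 (tmp_reg k) = eval f (\<lambda>i. R2 (var_reg i)) M" "\<forall>i<Suc d. R3 (var_reg i) = R2 (var_reg i)"
    "\<forall>j<k. R3 (tmp_reg j) = R2 (tmp_reg j)"
    using 7(2)[OF refl, of "Suc d" R2] c(3) wf(2) unfolding F_def E_def by (auto simp: add.assoc)
  ultimately have "reaches P (poly (cost e) (R (var_reg 0)) + (2 + poly (cost f) (R2 (var_reg 0)))) (p, R, M)
      (p + length E + 2 + length F, R3, M)"
    by (intro reaches_trans[OF R1(1)] reaches_trans)
  moreover have "R2 (var_reg 0) = R (var_reg 0)"
    using R1(3) x pos by (simp add: R2_def)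
  ultimately have "reaches P (poly (cost (Bind x e f)) (R (var_reg 0))) (p, R, M)
      (p + length (compile p k (Bind x e f)), R3, M)"
    unfolding code_eq by (simp add: algebra_simps)
  moreover have "eval f (\<lambda>i. R2 (var_reg i)) M = eval (Bind x e f) (\<lambda>i. R (var_reg i)) M"
    unfolding eval.simps using R1 wf x
    by (intro eval_cong[of "Suc d"]) (auto simp: R2_def less_Suc_eq)
  then have "R3 (tmp_reg k) = eval (Bind x e f) (\<lambda>i. R (var_reg i)) M" using R3(2) by simp
  moreover have "\<forall>i<d. R3 (var_reg i) = R (var_reg i)" "\<forall>j<k. R3 (tmp_reg j) = R (tmp_reg j)"
    using R1(3,4) R3(3,4) x by (simp_all add: R2_def)
  ultimately show ?case by blast
next
  case (8 p k x e f)
  define E where "E = compile p k e"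
  define q where "q = p + length E + 3"
  define body where "body = compile (q + 2) k f @ move (Suc k) (var_reg x) (tmp_reg k)"
  define N where "N = R (var_reg 0)"
  \<comment> \<open>The accumulator after \<open>i\<close> rounds.\<close>
  define s where "s i = fold (\<lambda>i s. eval f ((\<lambda>i. R (var_reg i))(x := s, Suc x := i)) M) [0..<i]
    (eval e (\<lambda>i. R (var_reg i)) M)" for i
  have code_eq: "compile p k (Loop x e f) = E @ move (Suc k) (var_reg x) (tmp_reg k) @ [Const (var_reg (Suc x)) 0] @
      loop q k (Suc x) body @ move k (tmp_reg k) (var_reg x)"
    by (simp add: Let_def E_def q_def body_def numeral_3_eq_3)
  have c: "code_at P p E" "code_at P (p + length E) (move (Suc k) (var_reg x) (tmp_reg k))"
    "code_at P (p + length E + 2) [Const (var_reg (Suc x)) 0]" "code_at P q (loop q k (Suc x) body)"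
    "code_at P (q + length body + 6) (move k (tmp_reg k) (var_reg x))"
    using 8(3) unfolding code_eq
    by (simp_all add: code_at_append code_at_Cons[of P _ _ "_ @ _"] q_def add.assoc numeral_3_eq_3)
  have cl: "code_at P (q + 2) (compile (q + 2) k f)"
    "code_at P (q + 2 + length (compile (q + 2) k f)) (move (Suc k) (var_reg x) (tmp_reg k))"
    using c(4) unfolding loop_def body_def
    by (simp_all add: code_at_append code_at_Cons[of P _ _ "_ @ _"] code_at_Cons[of P _ _ "_ # _"])
  have x: "x = d" and wf: "wf_exp d e" "wf_exp (Suc (Suc d)) f" and pos: "0 < d" using 8 by auto
  obtain R1 where R1: "reaches P (poly (cost e) N) (p, R, M) (p + length E, R1, M)"
    "R1 (tmp_reg k) = eval e (\<lambda>i. R (var_reg i)) M" "\<forall>i<d. R1 (var_reg i) = R (var_reg i)" "\<forall>j<k. R1 (tmp_reg j) = R (tmp_reg j)"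
    using 8(1)[OF c(1)[unfolded E_def] wf(1) pos, of R, folded E_def N_def] by blast
  define R2 where "R2 = R1(tmp_reg (Suc k) := 0, var_reg x := R1 (tmp_reg k))"
  have R2: "reaches P 2 (p + length E, R1, M) (p + length E + 2, R2, M)"
    unfolding R2_def by (intro reaches_move[OF c(2)]) simp
  define R3 where "R3 = R2(var_reg (Suc x) := 0)"
  have R3: "reaches P 1 (p + length E + 2, R2, M) (q, R3, M)"
    unfolding R3_def One_nat_def
    by (intro reaches_exec[OF c(3)]) (auto intro: reaches_refl simp: q_def numeral_3_eq_3)
  \<comment> \<open>Neither the counter nor \<open>tmp_reg k\<close> occurs, as
    \<open>reaches_loop\<close> demands.\<close>
  define I where "I i R' M' \<longleftrightarrow> M' = M \<and> R' (var_reg x) = s i \<and> (\<forall>i<d. R' (var_reg i) = R (var_reg i)) \<and>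
    (\<forall>j<k. R' (tmp_reg j) = R (tmp_reg j))" for i R' and M' :: "nat \<Rightarrow> nat"
  obtain R4 M4 where "reaches P (N * ((poly (cost f) N + 2) + 6) + 2) (q, R3, M)
      (q + length body + 6, R4, M4)" "I N R4 M4"
  proof -
    have "\<exists>R' M'. reaches P (poly (cost f) N + 2) (q + 2, Ra, Ma) (q + 2 + length body, R', M') \<and>
        I (Suc i) R' M' \<and> R' (var_reg (Suc x)) = i \<and> R' (var_reg 0) = N"
      if inv: "I i Ra Ma" "i < N" "Ra (var_reg (Suc x)) = i" "Ra (var_reg 0) = N" for i Ra Ma
    proof -
      have M: "Ma = M" using inv by (simp add: I_def)
      obtain Rb where Rb: "reaches P (poly (cost f) N) (q + 2, Ra, M)
          (q + 2 + length (compile (q + 2) k f), Rb, M)"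
        "Rb (tmp_reg k) = eval f (\<lambda>i. Ra (var_reg i)) M" "\<forall>i<Suc (Suc d). Rb (var_reg i) = Ra (var_reg i)"
        "\<forall>j<k. Rb (tmp_reg j) = Ra (tmp_reg j)"
        using 8(2)[OF refl refl, of "Suc (Suc d)" Ra] cl(1) wf(2) inv(4)
        unfolding E_def q_def by (auto simp: add.assoc numeral_3_eq_3)
      let ?Rc = "Rb(tmp_reg (Suc k) := 0, var_reg x := Rb (tmp_reg k))"
      have "reaches P 2 (q + 2 + length (compile (q + 2) k f), Rb, M)
          (q + 2 + length (compile (q + 2) k f) + 2, ?Rc, M)"
        by (intro reaches_move[OF cl(2)]) simp
      from reaches_trans[OF Rb(1) this]
      have "reaches P (poly (cost f) N + 2) (q + 2, Ra, Ma) (q + 2 + length body, ?Rc, M)"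
        by (simp add: M body_def add.assoc)
      moreover have "eval f (\<lambda>i. Ra (var_reg i)) M = s (Suc i)"
      proof -
        have "s (Suc i) = eval f ((\<lambda>i. R (var_reg i))(x := s i, Suc x := i)) M"
          by (simp add: s_def)
        also have "\<dots> = eval f (\<lambda>i. Ra (var_reg i)) M"
          using inv wf x by (intro eval_cong[of "Suc (Suc d)"]) (auto simp: I_def less_Suc_eq)
        finally show ?thesis ..
      qed
      ultimately show ?thesis
        using Rb inv x pos by (intro exI[of _ ?Rc] exI[of _ M] conjI) (auto simp: I_def)
    qed
    moreover have "I i (Ra(tmp_reg k := z)) Ma" "I i (Ra(var_reg (Suc x) := z)) Ma" if "I i Ra Ma" for i Ra Ma z
      using that x by (auto simp: I_def)
    moreover have "I 0 R3 M" "R3 (var_reg (Suc x)) = 0" "R3 (var_reg 0) = N"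
      using R1 x \<open>0 < d\<close> by (auto simp: I_def R3_def R2_def s_def N_def)
    ultimately show ?thesis
      using reaches_loop[OF c(4), of I N "poly (cost f) N + 2" R3 M] that by blast
  qed
  then have R4: "reaches P (N * ((poly (cost f) N + 2) + 6) + 2) (q, R3, M)
      (q + length body + 6, R4, M)" "I N R4 M"
    by (auto simp: I_def)
  define R5 where "R5 = R4(tmp_reg k := 0, tmp_reg k := R4 (var_reg x))"
  have "reaches P 2 (q + length body + 6, R4, M) (q + length body + 6 + 2, R5, M)"
    unfolding R5_def by (intro reaches_move[OF c(5)]) simp
  then have "reaches P (poly (cost e) N + (2 + (1 + ((N * ((poly (cost f) N + 2) + 6) + 2) + 2))))
      (p, R, M) (q + length body + 6 + 2, R5, M)"
    by (intro reaches_trans[OF R1(1)] reaches_trans[OF R2] reaches_trans[OF R3] reaches_trans[OF R4(1)])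
  moreover have "p + length (compile p k (Loop x e f)) = q + length body + 6 + 2"
    unfolding code_eq q_def by simp
  ultimately have "reaches P (poly (cost (Loop x e f)) (R (var_reg 0))) (p, R, M)
      (p + length (compile p k (Loop x e f)), R5, M)"
    by (simp only:) (erule reaches_mono, simp add: algebra_simps N_def)
  moreover have "R5 (tmp_reg k) = eval (Loop x e f) (\<lambda>i. R (var_reg i)) M"
    using R4(2) by (simp add: R5_def I_def s_def N_def)
  moreover have "\<forall>i<d. R5 (var_reg i) = R (var_reg i)" "\<forall>j<k. R5 (tmp_reg j) = R (tmp_reg j)"
    using R4(2) by (simp_all add: R5_def I_def)
  ultimately show ?case by blast
qed

text \<open>Between commands no temporary is live, so every \<open>Write\<close> starts again at
  temporary 0. The body of \<open>For\<close> begins at \<open>p + 3\<close>, after the clearing of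
  the counter and the two instructions of the loop test.\<close>

fun compile_cmd :: "nat \<Rightarrow> cmd \<Rightarrow> program" where
  "compile_cmd p (Write e f) =
     (let E = compile p 0 e; F = compile (p + length E) 1 f in E @ F @ [Store (tmp_reg 0) (tmp_reg 1)])"
| "compile_cmd p (Seq b c) =
     (let B = compile_cmd p b in B @ compile_cmd (p + length B) c)"
| "compile_cmd p (For x c) =
     [Const (var_reg x) 0] @ loop (Suc p) 0 x (compile_cmd (p + 3) c)"

primrec cost_cmd :: "cmd \<Rightarrow> nat poly" where
  "cost_cmd (Write e f) = cost e + cost f + 1"
| "cost_cmd (Seq b c) = cost_cmd b + cost_cmd c"
| "cost_cmd (For x c) = [:0, 1:] * (cost_cmd c + 6) + 3"

lemma reaches_compile_cmd:
  assumes "code_at P p (compile_cmd p c)" "wf_cmd d c" "0 < d"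
  shows "\<exists>R'. reaches P (poly (cost_cmd c) (R (var_reg 0))) (p, R, M)
      (p + length (compile_cmd p c), R', run c (\<lambda>i. R (var_reg i)) M) \<and> (\<forall>i<d. R' (var_reg i) = R (var_reg i))"
  using assms
proof (induction p c arbitrary: d R M rule: compile_cmd.induct)
  case (1 p e f)
  have wf: "wf_exp d e" "wf_exp d f" and pos: "0 < d" using 1 by simp_all
  define E where "E = compile p 0 e"
  define F where "F = compile (p + length E) 1 f"
  have c: "code_at P p E" "code_at P (p + length E) F"
    "code_at P (p + length E + length F) [Store (tmp_reg 0) (tmp_reg 1)]"
    using 1(1) unfolding compile_cmd.simps Let_def E_def[symmetric] F_def[symmetric]
    by (simp_all add: code_at_append add.assoc)
  obtain R1 where R1: "reaches P (poly (cost e) (R (var_reg 0))) (p, R, M) (p + length E, R1, M)"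
    "R1 (tmp_reg 0) = eval e (\<lambda>i. R (var_reg i)) M" "\<forall>i<d. R1 (var_reg i) = R (var_reg i)"
    using reaches_compile[OF c(1)[unfolded E_def] wf(1) pos, of R M, folded E_def] by blast
  obtain R2 where R2: "reaches P (poly (cost f) (R1 (var_reg 0))) (p + length E, R1, M)
      (p + length E + length F, R2, M)"
    "R2 (tmp_reg 1) = eval f (\<lambda>i. R1 (var_reg i)) M" "\<forall>i<d. R2 (var_reg i) = R1 (var_reg i)"
    "\<forall>j<1. R2 (tmp_reg j) = R1 (tmp_reg j)"
    using reaches_compile[OF c(2)[unfolded F_def] wf(2) pos, of R1 M, folded F_def] by blast
  have f: "eval f (\<lambda>i. R1 (var_reg i)) M = eval f (\<lambda>i. R (var_reg i)) M"
    using R1(3) wf pos by (intro eval_cong[of d]) auto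
  have "reaches P 1 (p + length E + length F, R2, M)
      (p + length E + length F + 1, R2, run (Write e f) (\<lambda>i. R (var_reg i)) M)"
    unfolding One_nat_def using R1(2) R2(2,4) f
    by (intro reaches_exec[OF c(3)]) (auto intro: reaches_refl)
  from reaches_trans[OF R1(1) reaches_trans[OF R2(1) this]]
  have "reaches P (poly (cost_cmd (Write e f)) (R (var_reg 0))) (p, R, M)
      (p + length (compile_cmd p (Write e f)), R2, run (Write e f) (\<lambda>i. R (var_reg i)) M)"
    using R1(3) pos by (simp add: Let_def E_def F_def add.assoc)
  then show ?case using R1(3) R2(3) by (metis (no_types, lifting))
next
  case (2 p b c)
  have wf: "wf_cmd d b" "wf_cmd d c" and pos: "0 < d" using 2 by simp_all
  define B where "B = compile_cmd p b"
  define C where "C = compile_cmd (p + length B) c"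
  have c: "code_at P p B" "code_at P (p + length B) C"
    using 2(3) unfolding compile_cmd.simps Let_def B_def[symmetric] C_def[symmetric]
    by (simp_all add: code_at_append add.assoc)
  let ?M = "run b (\<lambda>i. R (var_reg i)) M"
  obtain R1 where R1: "reaches P (poly (cost_cmd b) (R (var_reg 0))) (p, R, M) (p + length B, R1, ?M)"
    "\<forall>i<d. R1 (var_reg i) = R (var_reg i)"
    using 2(1)[OF c(1)[unfolded B_def] wf(1) pos, of R, folded B_def] by blast
  obtain R2 where R2: "reaches P (poly (cost_cmd c) (R1 (var_reg 0))) (p + length B, R1, ?M)
      (p + length B + length C, R2, run c (\<lambda>i. R1 (var_reg i)) ?M)" "\<forall>i<d. R2 (var_reg i) = R1 (var_reg i)"
    using 2(2)[OF B_def c(2)[unfolded C_def] wf(2) pos, of R1, folded C_def] by blast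
  have "run c (\<lambda>i. R1 (var_reg i)) ?M = run c (\<lambda>i. R (var_reg i)) ?M"
    using R1(2) wf pos by (intro run_cong[of d]) auto
  with reaches_trans[OF R1(1) R2(1)]
  have "reaches P (poly (cost_cmd (Seq b c)) (R (var_reg 0))) (p, R, M)
      (p + length (compile_cmd p (Seq b c)), R2, run (Seq b c) (\<lambda>i. R (var_reg i)) M)"
    using R1(2) pos by (simp add: Let_def B_def C_def add.assoc)
  then show ?case using R1(2) R2(2) by (metis (no_types, lifting))
next
  case (3 p x c)
  have x: "x = d" and wf: "wf_cmd (Suc d) c" and pos: "0 < d" using 3 by auto
  define body where "body = compile_cmd (p + 3) c"
  define N where "N = R (var_reg 0)"
  define s where "s i = fold (\<lambda>i. run c ((\<lambda>i. R (var_reg i))(x := i))) [0..<i] M" for i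
  have c: "code_at P p [Const (var_reg x) 0]" "code_at P (Suc p) (loop (Suc p) 0 x body)"
    using 3(2) code_at_Cons[of P p "Const (var_reg x) 0" "loop (Suc p) 0 x body"]
    unfolding body_def by simp_all
  have "code_at P (Suc p + 2) body"
    using c(2) unfolding loop_def
    by (simp add: code_at_append code_at_Cons[of P _ _ "_ @ _"] code_at_Cons[of P _ _ "_ # _"])
  moreover have "Suc p + 2 = p + 3" by simp
  ultimately have cb: "code_at P (p + 3) body" by metis
  define R1 where "R1 = R(var_reg x := 0)"
  have R1: "reaches P 1 (p, R, M) (Suc p, R1, M)"
    unfolding R1_def One_nat_def by (intro reaches_exec[OF c(1)]) (auto intro: reaches_refl)
  define I where "I i R' M' \<longleftrightarrow> M' = s i \<and> (\<forall>i<d. R' (var_reg i) = R (var_reg i))" for i R' M'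
  obtain R2 M2 where R2: "reaches P (N * (poly (cost_cmd c) N + 6) + 2) (Suc p, R1, M)
      (Suc p + length body + 6, R2, M2)" "I N R2 M2"
  proof -
    have "\<exists>R' M'. reaches P (poly (cost_cmd c) N) (Suc p + 2, Ra, Ma) (Suc p + 2 + length body, R', M') \<and>
        I (Suc i) R' M' \<and> R' (var_reg x) = i \<and> R' (var_reg 0) = N"
      if inv: "I i Ra Ma" "i < N" "Ra (var_reg x) = i" "Ra (var_reg 0) = N" for i Ra Ma
    proof -
      obtain Rb where Rb: "reaches P (poly (cost_cmd c) N) (p + 3, Ra, Ma)
          (p + 3 + length body, Rb, run c (\<lambda>i. Ra (var_reg i)) Ma)" "\<forall>i<Suc d. Rb (var_reg i) = Ra (var_reg i)"
        using 3(1)[OF cb[unfolded body_def] wf, of Ra Ma, folded body_def] inv(4) by auto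
      have "run c (\<lambda>i. Ra (var_reg i)) Ma = run c ((\<lambda>i. R (var_reg i))(x := i)) Ma"
        using inv x wf by (intro run_cong[of "Suc d"]) (auto simp: I_def less_Suc_eq)
      also have "\<dots> = s (Suc i)" using inv by (simp add: I_def s_def)
      finally have "I (Suc i) Rb (run c (\<lambda>i. Ra (var_reg i)) Ma)"
        using inv Rb(2) by (simp add: I_def)
      moreover have "Rb (var_reg x) = i" "Rb (var_reg 0) = N" using Rb(2) x inv by auto
      moreover have "Suc p + 2 = p + 3" by simp
      ultimately show ?thesis using Rb(1) by metis
    qed
    moreover have "I i (Ra(tmp_reg 0 := z)) Ma" "I i (Ra(var_reg x := z)) Ma" if "I i Ra Ma" for i Ra Ma z
      using that x by (auto simp: I_def)
    moreover have "I 0 R1 M" "R1 (var_reg x) = 0" "R1 (var_reg 0) = N"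
      using x pos by (auto simp: I_def R1_def s_def N_def)
    moreover have "0 < x" using x pos by simp
    ultimately show ?thesis
      using reaches_loop[OF c(2), of I N "poly (cost_cmd c) N" R1 M] that by blast
  qed
  have "p + length (compile_cmd p (For x c)) = Suc p + length body + 6"
    by (simp add: body_def)
  moreover have "reaches P (poly (cost_cmd (For x c)) (R (var_reg 0))) (p, R, M) (Suc p + length body + 6, R2, M2)"
    by (rule reaches_mono[OF reaches_trans[OF R1 R2(1)]]) (simp add: N_def algebra_simps)
  moreover have "M2 = run (For x c) (\<lambda>i. R (var_reg i)) M"
    using R2(2) by (simp add: I_def s_def N_def)
  moreover have "\<forall>i<d. R2 (var_reg i) = R (var_reg i)" using R2(2) by (simp add: I_def)
  ultimately show ?case by metis
qed

section \<open>From commands to polynomial time\<close>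

definition program_of :: "cmd \<Rightarrow> program" where
  "program_of c = Load (var_reg 0) (tmp_reg 0) # compile_cmd 1 c"

definition memory :: "nat list \<Rightarrow> nat \<Rightarrow> nat" where
  "memory xs i = (if i < length xs then xs ! i else 0)"

lemma poly_nat_mono: "m \<le> n \<Longrightarrow> poly p m \<le> poly p (n::nat)"
  by (induction p) (auto intro: add_mono mult_mono)

lemma length_le_input_size: "length xs \<le> input_size xs"
  by (induction xs) (auto simp: input_size_def)

text \<open>The cost is a polynomial in the first input number, which is at most the length of the
  input and so at most its size. The program depends on the command alone and not on
  \<open>D\<close>; this is what gives one program for all weight bounds.\<close>

lemma solves_program_of:
  assumes wf: "wf_cmd 1 c"
    and enc: "\<And>x. x \<in> D \<Longrightarrow> memory (enc x) 0 \<le> length (enc x)"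
    and correct: "\<And>x. x \<in> D \<Longrightarrow> Q x (run c ((\<lambda>_. 0)(0 := memory (enc x) 0)) (memory (enc x)))"
  shows "solves_in_polytime (program_of c) D enc Q"
  unfolding solves_in_polytime_def
proof (intro exI[of _ "cost_cmd c + 1"] ballI)
  fix x assume x: "x \<in> D"
  define xs where "xs = enc x"
  define n where "n = memory xs 0"
  define P where "P = program_of c"
  have P: "P = [] @ [Load (var_reg 0) (tmp_reg 0)] @ compile_cmd 1 c @ []"
    by (simp add: P_def program_of_def)
  have c: "code_at P 0 [Load (var_reg 0) (tmp_reg 0)]" "code_at P 1 (compile_cmd 1 c)"
    using P code_at_append[of P 0 "[Load (var_reg 0) (tmp_reg 0)]" "compile_cmd 1 c"]
    unfolding code_at_def by (fastforce simp: P)+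
  define R0 :: "nat \<Rightarrow> nat" where "R0 = (\<lambda>_. 0)(var_reg 0 := n)"
  have "init_config xs = (0, \<lambda>_. 0, memory xs)"
    by (auto simp: init_config_def memory_def fun_eq_iff)
  \<comment> \<open>\<open>tmp_reg 0\<close> is still 0 and serves as the address of the first input
    number.\<close>
  then have "reaches P 1 (init_config xs) (1, R0, memory xs)"
    unfolding One_nat_def
    by (simp only:) (intro reaches_exec[OF c(1)], auto intro: reaches_refl simp: R0_def n_def)
  moreover obtain R1 where "reaches P (poly (cost_cmd c) (R0 (var_reg 0))) (1, R0, memory xs)
      (1 + length (compile_cmd 1 c), R1, run c (\<lambda>i. R0 (var_reg i)) (memory xs))"
    using reaches_compile_cmd[OF c(2) wf, of R0 "memory xs"] by auto
  ultimately have "reaches P (1 + poly (cost_cmd c) (R0 (var_reg 0))) (init_config xs)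
      (1 + length (compile_cmd 1 c), R1, run c (\<lambda>i. R0 (var_reg i)) (memory xs))"
    by (rule reaches_trans)
  \<comment> \<open>Natural coefficients make the cost monotone.\<close>
  moreover have "1 + poly (cost_cmd c) (R0 (var_reg 0)) \<le> poly (cost_cmd c + 1) (input_size xs)"
    using enc[OF x] length_le_input_size[of xs] by (auto simp: R0_def n_def xs_def intro: poly_nat_mono)
  ultimately have "reaches P (poly (cost_cmd c + 1) (input_size xs)) (init_config xs)
      (1 + length (compile_cmd 1 c), R1, run c (\<lambda>i. R0 (var_reg i)) (memory xs))"
    by (rule reaches_mono)
  moreover have "(\<lambda>i. R0 (var_reg i)) = (\<lambda>_. 0)(0 := n)" by (auto simp: R0_def)
  moreover have "halted P (1 + length (compile_cmd 1 c), R1, M)" for M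
    by (simp add: halted_def P_def program_of_def)
  ultimately show "\<exists>t\<le>poly (cost_cmd c + 1) (input_size (enc x)). \<exists>pc R M.
      (step (program_of c) ^^ t) (init_config (enc x)) = (pc, R, M) \<and>
      halted (program_of c) (pc, R, M) \<and> Q x M"
    using correct[OF x] unfolding reaches_def P_def n_def xs_def by metis
qed

section \<open>Weighted depth and forest orders\<close>

lemma successively_rtrancl:
  "successively (\<lambda>u v. F v = Some u) xs \<Longrightarrow> x \<in> set xs \<Longrightarrow> (x, last xs) \<in> (parent_rel F)\<^sup>*"
proof (induction xs arbitrary: x)
  case (Cons y xs)
  show ?case
  proof (cases "xs = []")
    case False
    then have "(y, hd xs) \<in> parent_rel F"
      using Cons.prems by (cases xs) (auto simp: parent_rel_def)
    moreover have s: "successively (\<lambda>u v. F v = Some u) xs"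
      using Cons.prems by (cases xs) auto
    then have "(hd xs, last xs) \<in> (parent_rel F)\<^sup>*"
      using Cons.IH False by simp
    ultimately have "(y, last xs) \<in> (parent_rel F)\<^sup>*"
      by (rule converse_rtrancl_into_rtrancl)
    then show ?thesis using Cons s False by auto
  qed (use Cons in simp)
qed simp

lemma single_valued_parent: "single_valued ((parent_rel F)\<inverse>)"
  by (auto simp: single_valued_def parent_rel_def)

text \<open>Parents are unique, so the converse of \<open>parent_rel\<close> is deterministic and
  two ascents from \<open>v\<close> run along the same path.\<close>

lemma ancestors_chain:
  assumes "(x, v) \<in> (parent_rel F)\<^sup>*" "(y, v) \<in> (parent_rel F)\<^sup>*"
  shows "(x, y) \<in> (parent_rel F)\<^sup>* \<or> (y, x) \<in> (parent_rel F)\<^sup>*"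
  using single_valued_confluent[OF single_valued_parent[of F], of v x y] assms
  by (auto simp: rtrancl_converse)

text \<open>An ascent from the last vertex can only retrace the path, since parents are unique, and
  it cannot pass the top because the path starts at a root.\<close>

lemma path_ancestors:
  assumes "successively (\<lambda>u v. F v = Some u) xs" "xs \<noteq> []" "F (hd xs) = None"
  shows "set xs = {u. (u, last xs) \<in> (parent_rel F)\<^sup>*}"
proof -
  have "u \<in> set xs" if "(u, last xs) \<in> (parent_rel F)\<^sup>*" for u
    using that
  proof (induction rule: converse_rtrancl_induct)
    case base
    then show ?case using assms by simp
  next
    case (step y z)
    then obtain i where i: "i < length xs" "z = xs ! i" by (metis in_set_conv_nth)
    have F: "F z = Some y" using step by (simp add: parent_rel_def)
    then have "i \<noteq> 0" using i assms by (metis hd_conv_nth option.distinct(1))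
    then obtain j where "i = Suc j" by (cases i) auto
    then have "F z = Some (xs ! j)"
      using assms(1) i by (auto simp: successively_conv_nth)
    then show ?case using F i \<open>i = Suc j\<close> by auto
  qed
  then show ?thesis using successively_rtrancl[OF assms(1)] by blast
qed

lemma path_distinct:
  assumes "acyclic (parent_rel F)" "successively (\<lambda>u v. F v = Some u) xs"
  shows "distinct xs"
  using assms(2)
proof (induction xs)
  case (Cons y xs)
  show ?case
  proof (cases "xs = []")
    case False
    have s: "successively (\<lambda>u v. F v = Some u) xs"
      using Cons.prems by (cases xs) auto
    have "y \<notin> set xs"
    proof
      assume "y \<in> set xs"
      then obtain ys zs where yz: "xs = ys @ y # zs" by (meson split_list)
      have "successively (\<lambda>u v. F v = Some u) ((ys @ [y]) @ zs)"
        using s yz by simp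
      then have "successively (\<lambda>u v. F v = Some u) (ys @ [y])"
        unfolding successively_append_iff by blast
      from successively_rtrancl[OF this, of "hd (ys @ [y])"]
      have "(hd (ys @ [y]), y) \<in> (parent_rel F)\<^sup>*" by (cases ys) auto
      moreover have "(y, hd (ys @ [y])) \<in> parent_rel F"
        using Cons.prems yz by (cases ys) (auto simp: parent_rel_def)
      ultimately have "(y, y) \<in> (parent_rel F)\<^sup>+" by (meson rtrancl_into_trancl2)
      then show False using assms(1) by (simp add: acyclic_def)
    qed
    then show ?thesis using Cons.IH[OF s] by simp
  qed simp
qed simp

text \<open>The weight of the path from the root to \<open>v\<close>. Sets of ancestors replace
  lists, and inner vertices get a depth as well.\<close>

definition depth_of :: "'a set \<Rightarrow> ('a \<Rightarrow> nat) \<Rightarrow> ('a \<Rightarrow> 'a option) \<Rightarrow> 'a \<Rightarrow> nat" where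
  "depth_of V w F v = (\<Sum>u | u \<in> V \<and> (u, v) \<in> (parent_rel F)\<^sup>*. w u)"

lemma ancestor_in:
  assumes "rooted_forest V F" "(u, v) \<in> (parent_rel F)\<^sup>*" "v \<in> V"
  shows "u \<in> V"
  using assms(2,3)
proof (induction rule: converse_rtrancl_induct)
  case (step y z)
  then show ?case
    using assms(1) by (auto simp: rooted_forest_def parent_rel_def ran_def)
qed simp

lemma finite_parent_rel: "rooted_forest V F \<Longrightarrow> finite (parent_rel F)"
  by (rule finite_subset[of _ "V \<times> V"])
     (auto simp: rooted_forest_def parent_rel_def ran_def dom_def)

lemma path_to:
  assumes "rooted_forest V F" "v \<in> V"
  shows "\<exists>xs. xs \<noteq> [] \<and> set xs \<subseteq> V \<and> F (hd xs) = None \<and> successively (\<lambda>u v. F v = Some u) xs \<and>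
    last xs = v"
proof -
  have "wf (parent_rel F)"
    using assms finite_parent_rel by (auto simp: rooted_forest_def intro: finite_acyclic_wf)
  then show ?thesis using assms(2)
  proof (induction v rule: wf_induct_rule)
    case (less v)
    show ?case
    proof (cases "F v")
      case None
      then show ?thesis using less by (intro exI[of _ "[v]"]) simp
    next
      case (Some u)
      then have "u \<in> V" using assms(1) by (auto simp: rooted_forest_def ran_def)
      then obtain xs where xs: "xs \<noteq> []" "set xs \<subseteq> V" "F (hd xs) = None"
        "successively (\<lambda>u v. F v = Some u) xs" "last xs = u"
        using less(1)[of u] Some by (auto simp: parent_rel_def)
      then show ?thesis
        using Some less.prems
        by (intro exI[of _ "xs @ [v]"]) (auto simp: successively_append_iff)
    qed
  qed
qed

lemma leaf_below:
  assumes "rooted_forest V F" "v \<in> V"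
  shows "\<exists>l\<in>V. l \<notin> ran F \<and> (v, l) \<in> (parent_rel F)\<^sup>*"
proof -
  have "acyclic (parent_rel F)" using assms by (simp add: rooted_forest_def)
  then have "wf ((parent_rel F)\<inverse>)"
    using finite_parent_rel[OF assms(1)] by (simp add: finite_acyclic_wf_converse)
  then show ?thesis using assms(2)
  proof (induction v rule: wf_induct_rule)
    case (less v)
    show ?case
    proof (cases "v \<in> ran F")
      case True
      then obtain z where z: "F z = Some v" by (auto simp: ran_def)
      then have "z \<in> V" using assms(1) by (auto simp: rooted_forest_def)
      then obtain l where "l \<in> V" "l \<notin> ran F" "(z, l) \<in> (parent_rel F)\<^sup>*"
        using less(1)[of z] z by (auto simp: parent_rel_def)
      moreover have "(v, z) \<in> parent_rel F" using z by (simp add: parent_rel_def)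
      ultimately show ?thesis by (meson converse_rtrancl_into_rtrancl)
    qed (use less in blast)
  qed
qed

lemma path_weight:
  assumes "rooted_forest V F" "xs \<noteq> []" "set xs \<subseteq> V" "F (hd xs) = None"
    "successively (\<lambda>u v. F v = Some u) xs"
  shows "sum_list (map w xs) = depth_of V w F (last xs)"
proof -
  have "sum_list (map w xs) = sum w (set xs)"
    using path_distinct[OF _ assms(5)] assms(1)
    by (simp add: rooted_forest_def sum_list_distinct_conv_sum_set)
  also have "set xs = {u. u \<in> V \<and> (u, last xs) \<in> (parent_rel F)\<^sup>*}"
    using path_ancestors[OF assms(5,2,4)] assms(3) by auto
  finally show ?thesis by (simp add: depth_of_def)
qed

text \<open>Depth does not decrease downwards and every vertex has a leaf below it, so the maximum
  over leaves is the maximum over all vertices.\<close>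

lemma weighted_depth_eq:
  assumes F: "rooted_forest V F" and "V \<noteq> {}"
  shows "weighted_depth V w F = Max (depth_of V w F ` V)"
proof -
  have fin: "finite V" using F by (simp add: rooted_forest_def)
  let ?W = "{sum_list (map w xs) | xs. root_to_leaf_path V F xs}"
  have sub: "?W \<subseteq> depth_of V w F ` V"
  proof
    fix s assume "s \<in> ?W"
    then obtain xs where xs: "s = sum_list (map w xs)" "root_to_leaf_path V F xs" by blast
    then have "s = depth_of V w F (last xs)"
      using path_weight[OF F] by (auto simp: root_to_leaf_path_def)
    moreover have "last xs \<in> V" using xs by (auto simp: root_to_leaf_path_def)
    ultimately show "s \<in> depth_of V w F ` V" by blast
  qed
  have ex: "\<exists>s\<in>?W. depth_of V w F v \<le> s" if v: "v \<in> V" for v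
  proof -
    obtain l where l: "l \<in> V" "l \<notin> ran F" "(v, l) \<in> (parent_rel F)\<^sup>*"
      using leaf_below[OF F v] by blast
    obtain xs where xs: "xs \<noteq> []" "set xs \<subseteq> V" "F (hd xs) = None"
      "successively (\<lambda>u v. F v = Some u) xs" "last xs = l"
      using path_to[OF F l(1)] by blast
    have "depth_of V w F v \<le> depth_of V w F l"
      unfolding depth_of_def using l(3) fin by (intro sum_mono2) auto
    also have "\<dots> = sum_list (map w xs)"
      using path_weight[OF F xs(1-4)] xs(5) by simp
    finally show ?thesis
      using xs l unfolding root_to_leaf_path_def by blast
  qed
  have finW: "finite ?W" using sub fin by (meson finite_imageI finite_subset)
  have ne: "?W \<noteq> {}" using ex \<open>V \<noteq> {}\<close> by blast
  show ?thesis unfolding weighted_depth_def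
  proof (rule antisym)
    show "Max ?W \<le> Max (depth_of V w F ` V)"
      using sub fin ne by (intro Max_mono) auto
    show "Max (depth_of V w F ` V) \<le> Max ?W"
    proof (intro Max.boundedI)
      fix x assume "x \<in> depth_of V w F ` V"
      then obtain s where "s \<in> ?W" "x \<le> s" using ex by blast
      then show "x \<le> Max ?W" using finW Max_ge order_trans by blast
    qed (use fin \<open>V \<noteq> {}\<close> in auto)
  qed
qed

section \<open>Forests from orders whose sets of ancestors are chains\<close>

locale forest_order =
  fixes V :: "'a set" and w :: "'a \<Rightarrow> nat" and anc :: "'a \<Rightarrow> 'a \<Rightarrow> bool"
  assumes fin: "finite V"
    and pos: "v \<in> V \<Longrightarrow> 0 < w v"
    and refl: "v \<in> V \<Longrightarrow> anc v v"
    and antisym: "u \<in> V \<Longrightarrow> v \<in> V \<Longrightarrow> anc u v \<Longrightarrow> anc v u \<Longrightarrow> u = v"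
    and trans: "x \<in> V \<Longrightarrow> y \<in> V \<Longrightarrow> z \<in> V \<Longrightarrow> anc x y \<Longrightarrow> anc y z \<Longrightarrow> anc x z"
    and chain: "x \<in> V \<Longrightarrow> y \<in> V \<Longrightarrow> z \<in> V \<Longrightarrow> anc x z \<Longrightarrow> anc y z \<Longrightarrow> anc x y \<or> anc y x"
begin

text \<open>Since weights are positive, this is strictly increasing along the order and serves as a
  rank; being a plain sum, it can also be evaluated by a loop.\<close>

definition height :: "'a \<Rightarrow> nat" where
  "height v = (\<Sum>u | u \<in> V \<and> anc u v. w u)"

text \<open>The parent of a vertex is its unique strict ancestor whose height leaves room for nothing but
  the vertex itself.\<close>

definition covers :: "'a \<Rightarrow> 'a \<Rightarrow> bool" where
  "covers z v \<longleftrightarrow> z \<noteq> v \<and> anc z v \<and> height z + w v = height v"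

text \<open>A property and not a function, because it is used for two maps: one obtained by choice,
  which shows that the depth is attained, and the array that the machine writes.\<close>

definition parent_map :: "('a \<Rightarrow> 'a option) \<Rightarrow> bool" where
  "parent_map F \<longleftrightarrow>
     (\<forall>v z. F v = Some z \<longrightarrow> v \<in> V \<and> z \<in> V \<and> covers z v) \<and>
     (\<forall>v. F v = None \<longrightarrow> v \<in> V \<longrightarrow> (\<forall>z\<in>V. \<not> covers z v))"

lemma parent_map_exists: "\<exists>F. parent_map F"
  unfolding parent_map_def
  by (rule exI[of _ "\<lambda>v. if v \<in> V \<and> (\<exists>z\<in>V. covers z v)
      then Some (SOME z. z \<in> V \<and> covers z v) else None"])
    (auto intro: someI2)

lemma height_strict:
  assumes "u \<in> V" "v \<in> V" "u \<noteq> v" "anc u v"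
  shows "height u + w v \<le> height v"
proof -
  have "height u + w v = sum w (insert v {x. x \<in> V \<and> anc x u})"
    using assms antisym[of u v] fin unfolding height_def by (subst sum.insert) auto
  also have "\<dots> \<le> height v"
    unfolding height_def using assms fin refl[of v]
    by (intro sum_mono2) (auto intro: trans[of _ u v])
  finally show ?thesis .
qed

text \<open>A strict ancestor of maximal height is the parent: the strict ancestors form a chain,
  and any of them below it would have a greater height.\<close>

lemma covers_exists:
  assumes v: "v \<in> V" and u: "u \<in> V" "u \<noteq> v" "anc u v"
  shows "\<exists>z\<in>V. covers z v"
proof -
  let ?A = "{x. x \<in> V \<and> x \<noteq> v \<and> anc x v}"
  have A: "finite ?A" "u \<in> ?A" using fin u by auto
  then have "Max (height ` ?A) \<in> height ` ?A" by (intro Max_in) auto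
  then obtain z where z: "z \<in> ?A" "height z = Max (height ` ?A)" by auto
  then have z_max: "height x \<le> height z" if "x \<in> ?A" for x
    using A that by simp
  have "{x. x \<in> V \<and> anc x v} = insert v {x. x \<in> V \<and> anc x z}"
  proof (intro set_eqI iffI)
    fix x assume x: "x \<in> {x. x \<in> V \<and> anc x v}"
    show "x \<in> insert v {x. x \<in> V \<and> anc x z}"
    proof (cases "x = v")
      case False
      then have xA: "x \<in> ?A" using x by auto
      have "anc x z \<or> anc z x" using chain[of x z v] xA z(1) v by auto
      moreover have "x = z" if "anc z x"
      proof (rule ccontr)
        assume "x \<noteq> z"
        then have "height z + w x \<le> height x" using height_strict[of z x] that z(1) xA by auto
        then show False using z_max[OF xA] pos[of x] xA by auto
      qed
      ultimately show ?thesis using xA refl[of z] z(1) by auto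
    qed simp
  next
    fix x assume "x \<in> insert v {x. x \<in> V \<and> anc x z}"
    then show "x \<in> {x. x \<in> V \<and> anc x v}" using z(1) v refl[of v] trans[of x z v] by auto
  qed
  moreover have "\<not> anc v z" using z(1) v antisym[of z v] by auto
  ultimately have "height v = height z + w v"
    using fin v unfolding height_def by simp
  then show ?thesis using z(1) by (auto simp: covers_def)
qed

text \<open>Heights strictly decrease towards parents, which gives acyclicity. That ascending along
  parents reaches every \<open>anc\<close>-ancestor is shown by induction on the height.\<close>

lemma forest_of_order:
  assumes F: "parent_map F"
  shows "rooted_forest V F" "\<And>u v. v \<in> V \<Longrightarrow> (u, v) \<in> (parent_rel F)\<^sup>* \<longleftrightarrow> u \<in> V \<and> anc u v"
proof -
  have some: "v \<in> V \<and> z \<in> V \<and> covers z v" if "F v = Some z" for v z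
    using F that by (simp add: parent_map_def)
  have none: "\<not> covers z v" if "F v = None" "v \<in> V" "z \<in> V" for v z
    using F that by (simp add: parent_map_def)
  have lt: "height u < height v" if "(u, v) \<in> parent_rel F" for u v
    using some[of v u] that pos[of v] by (auto simp: parent_rel_def covers_def)
  have "height u < height v" if "(u, v) \<in> (parent_rel F)\<^sup>+" for u v
    using that by (induction rule: trancl_induct) (auto dest!: lt)
  then have "acyclic (parent_rel F)" by (auto simp: acyclic_def)
  then show forest: "rooted_forest V F"
    using some fin by (auto simp: rooted_forest_def ran_def)
  show "(u, v) \<in> (parent_rel F)\<^sup>* \<longleftrightarrow> u \<in> V \<and> anc u v" if v: "v \<in> V" for u v
  proof
    assume "(u, v) \<in> (parent_rel F)\<^sup>*"
    then show "u \<in> V \<and> anc u v"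
    proof (induction rule: converse_rtrancl_induct)
      case (step y z)
      then have "y \<in> V" "z \<in> V" "anc y z"
        using some[of z y] by (auto simp: parent_rel_def covers_def)
      then show ?case using step trans[of y z v] v by auto
    qed (simp add: v refl)
  next
    assume "u \<in> V \<and> anc u v"
    then show "(u, v) \<in> (parent_rel F)\<^sup>*" using v
    proof (induction "height v" arbitrary: v rule: less_induct)
      case less
      show ?case
      proof (cases "u = v")
        case False
        obtain z where z: "F v = Some z"
          using covers_exists[of v u] none[of v] less False by fastforce
        then have z': "z \<in> V" "z \<noteq> v" "anc z v" "height z + w v = height v"
          using some by (auto simp: covers_def)
        \<comment> \<open>Otherwise \<open>u\<close> would lie strictly between \<open>z\<close> and
          \<open>v\<close>, and \<open>height v\<close> would exceed \<open>height z\<close> by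
          \<open>w u\<close> in addition to \<open>w v\<close>.\<close>
        have "anc u z"
        proof (rule ccontr)
          assume n: "\<not> anc u z"
          then have "anc z u" using chain[of u z v] less z' by auto
          moreover have "z \<noteq> u" using n z' refl[of z] by auto
          ultimately have "height z + w u \<le> height u" using height_strict[of z u] less z' by auto
          moreover have "height u + w v \<le> height v" using height_strict less False by auto
          ultimately show False using z'(4) pos[of u] less by auto
        qed
        moreover have "height z < height v" using z'(4) pos[of v] less.prems by auto
        ultimately have "(u, z) \<in> (parent_rel F)\<^sup>*" using less.hyps[of z] less.prems z' by auto
        then show ?thesis using z by (auto simp: parent_rel_def intro: rtrancl_into_rtrancl)
      qed simp
    qed
  qed
qed

end

section \<open>Optimal decompositions of subdivided stars\<close>

text \<open>Branches are indexed by their middle vertices, with \<open>c\<close> giving the leaf of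
  a branch. The linear order on the vertices breaks ties between leaves of equal weight.\<close>

locale subdivided =
  fixes V :: "'a::linorder set" and E :: "'a set set" and w :: "'a \<Rightarrow> nat"
    and a :: 'a and B :: "'a set" and c :: "'a \<Rightarrow> 'a"
  assumes fin_B: "finite B" and inj_c: "inj_on c B"
    and disjoint: "a \<notin> B" "a \<notin> c ` B" "B \<inter> c ` B = {}"
    and V_eq: "V = insert a (B \<union> c ` B)"
    and E_eq: "E = (\<lambda>b. {a, b}) ` B \<union> (\<lambda>b. {b, c b}) ` B"
    and w_pos: "v \<in> V \<Longrightarrow> 0 < w v"
begin

lemma fin_V: "finite V"
  using fin_B by (simp add: V_eq)

lemma c_simps [simp]:
  assumes "b \<in> B"
  shows "b \<noteq> a" "a \<noteq> b" "c b \<noteq> a" "a \<noteq> c b" "c b \<notin> B" "c b \<noteq> b" "b \<noteq> c b"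
  using assms disjoint by (force simp: image_iff disjoint_iff)+

lemma c_neq [simp]: "b \<in> B \<Longrightarrow> x \<in> B \<Longrightarrow> c b \<noteq> x" "b \<in> B \<Longrightarrow> x \<in> B \<Longrightarrow> x \<noteq> c b"
  using disjoint by (force simp: image_iff disjoint_iff)+

lemma c_inj [simp]: "b \<in> B \<Longrightarrow> b' \<in> B \<Longrightarrow> c b = c b' \<longleftrightarrow> b = b'"
  using inj_c by (auto simp: inj_on_def)

lemma a_notin_B [simp]: "a \<notin> B"
  by (fact disjoint)

lemma V_cases [consumes 1, case_names centre mid leaf]:
  assumes "v \<in> V"
  obtains "v = a" | "v \<in> B" | b where "b \<in> B" "v = c b"
  using assms unfolding V_eq by blast

lemma in_V [simp]: "a \<in> V" "b \<in> B \<Longrightarrow> b \<in> V" "b \<in> B \<Longrightarrow> c b \<in> V"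
  by (auto simp: V_eq)

text \<open>Lets \<open>anc\<close> treat a leaf like the middle vertex it hangs from.\<close>

definition mid :: "'a \<Rightarrow> 'a" where
  "mid v = (if v \<in> c ` B then the_inv_into B c v else v)"

lemma mid_simps [simp]: "mid a = a" "b \<in> B \<Longrightarrow> mid b = b" "b \<in> B \<Longrightarrow> mid (c b) = b"
  using disjoint inj_c by (auto simp: mid_def the_inv_into_f_f)

definition tail :: "'a \<Rightarrow> nat" where "tail b = w b + w (c b)"

text \<open>Indexing the candidates by vertices lets a loop of length n run through them. The
  default 0 is a genuine candidate: as weights are positive, it places all middle vertices above the
  centre.\<close>

definition threshold :: "'a \<Rightarrow> nat" where
  "threshold x = (if x \<in> B then tail x else 0)"

text \<open>Strict, so that a vertex attaining the threshold stays below the centre.\<close>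

definition above :: "nat \<Rightarrow> 'a set" where "above t = {b \<in> B. t < tail b}"

text \<open>Jackson's rule: the middle vertices above the centre are ordered by decreasing leaf weight.\<close>

definition before :: "'a \<Rightarrow> 'a \<Rightarrow> bool" where
  "before u v \<longleftrightarrow> w (c v) < w (c u) \<or> w (c v) = w (c u) \<and> u \<le> v"

text \<open>The forest is a chain of \<open>above t\<close> ordered by \<open>before\<close>,
  followed by the centre; the other middle vertices are children of the centre, and each leaf hangs
  from its middle vertex. In the last disjunct, a vertex of the chain fails to be an ancestor only
  on the branches of chain vertices preceding it.\<close>

definition anc :: "nat \<Rightarrow> 'a \<Rightarrow> 'a \<Rightarrow> bool" where
  "anc t u v \<longleftrightarrow> u = v \<or> u = mid v \<or>
     (if u \<in> above t then mid v \<in> above t \<longrightarrow> before u (mid v) else u = a \<and> mid v \<notin> above t)"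

lemma before_trans: "before x y \<Longrightarrow> before y z \<Longrightarrow> before x z"
  by (auto simp: before_def)

lemma before_antisym: "before x y \<Longrightarrow> before y x \<Longrightarrow> x = y"
  by (auto simp: before_def)

lemma before_total: "before x y \<or> before y x"
  by (auto simp: before_def)

lemma above_simps [simp]: "a \<notin> above t" "b \<in> B \<Longrightarrow> c b \<notin> above t"
  by (auto simp: above_def)

lemma above_B: "b \<in> above t \<Longrightarrow> b \<in> B"
  by (auto simp: above_def)

lemma anc_centre: "anc t u a \<longleftrightarrow> u = a \<or> u \<in> above t"
  by (simp add: anc_def)

lemma anc_above: "b \<in> above t \<Longrightarrow> anc t u b \<longleftrightarrow> u \<in> above t \<and> before u b"
  using above_B[of b t] by (auto simp: anc_def before_def split: if_splits)

lemma anc_below: "b \<in> B \<Longrightarrow> b \<notin> above t \<Longrightarrow> anc t u b \<longleftrightarrow> u = b \<or> u = a \<or> u \<in> above t"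
  by (auto simp: anc_def)

lemma anc_leaf: "b \<in> B \<Longrightarrow> anc t u (c b) \<longleftrightarrow> u = c b \<or> anc t u b"
  by (auto simp: anc_def)

text \<open>The order laws are first checked on the centre and the middle vertices, where three
  cases list all ancestors; a leaf only adds itself to the ancestors of its middle vertex.\<close>

lemma anc_mid_trans:
  assumes "z \<in> insert a B" "anc t x y" "anc t y z"
  shows "anc t x z"
proof -
  consider "z = a" | "z \<in> above t" | "z \<in> B" "z \<notin> above t" using assms by blast
  then show ?thesis
  proof cases
    case 1
    then show ?thesis using assms by (auto simp: anc_centre anc_above)
  next
    case 2
    then show ?thesis using assms by (auto simp: anc_above intro: before_trans)
  next
    case 3
    then have "y = z \<or> y = a \<or> y \<in> above t" using assms by (simp add: anc_below)
    then show ?thesis using assms 3 by (auto simp: anc_below anc_centre anc_above)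
  qed
qed

lemma anc_mid_chain:
  assumes "z \<in> insert a B" "anc t x z" "anc t y z"
  shows "anc t x y \<or> anc t y x"
proof -
  consider "z = a" | "z \<in> above t" | "z \<in> B" "z \<notin> above t" using assms by blast
  then show ?thesis
  proof cases
    case 1
    then show ?thesis using assms before_total[of x y] by (auto simp: anc_centre anc_above)
  next
    case 2
    then show ?thesis using assms before_total[of x y] by (auto simp: anc_above)
  next
    case 3
    then have "x = z \<or> x = a \<or> x \<in> above t" "y = z \<or> y = a \<or> y \<in> above t"
      using assms by (simp_all add: anc_below)
    then show ?thesis
      using assms 3 before_total[of x y] by (elim disjE) (simp_all add: anc_below anc_centre anc_above)
  qed
qed

lemma anc_in_core: "b \<in> B \<Longrightarrow> v \<in> insert a B \<Longrightarrow> \<not> anc t (c b) v"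
  using above_B[of v t] by (cases "v \<in> above t") (auto simp: anc_centre anc_above anc_below)

lemma anc_mid_antisym:
  assumes "x \<in> insert a B" "y \<in> insert a B" "anc t x y" "anc t y x"
  shows "x = y"
proof -
  consider "y = a" | "y \<in> above t" | "y \<in> B" "y \<notin> above t" using assms by blast
  then show ?thesis
  proof cases
    case 1
    then show ?thesis using assms above_B[of x t] by (auto simp: anc_centre anc_above)
  next
    case 2
    then show ?thesis using assms before_antisym[of x y] by (auto simp: anc_above)
  next
    case 3
    then have "x = y \<or> x = a \<or> x \<in> above t" using assms by (simp add: anc_below)
    then show ?thesis using 3 assms(4) by (auto simp: anc_centre anc_above)
  qed
qed

lemma core_or_leaf: "v \<in> V \<Longrightarrow> v \<in> insert a B \<or> (\<exists>b\<in>B. v = c b)"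
  by (auto simp: V_eq)

sublocale fo: forest_order V w "anc t" for t
proof
  show "finite V" by (fact fin_V)
  show "0 < w v" if "v \<in> V" for v using w_pos that .
  show "anc t v v" for v by (simp add: anc_def)
  fix x y z assume V: "x \<in> V" "y \<in> V" "z \<in> V"
  show "x = y" if xy: "anc t x y" "anc t y x"
  proof (cases "x \<in> insert a B \<and> y \<in> insert a B")
    case True
    then show ?thesis using anc_mid_antisym xy by blast
  next
    case False
    then obtain b where b: "b \<in> B" "x = c b \<or> y = c b" using core_or_leaf V by blast
    then have "x \<notin> insert a B \<or> y \<notin> insert a B" by auto
    then show ?thesis
      using core_or_leaf[OF V(1)] core_or_leaf[OF V(2)] xy anc_in_core
      by (elim disjE bexE) (auto simp: anc_leaf)
  qed
  show "anc t x z" if xyz: "anc t x y" "anc t y z"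
    using core_or_leaf[OF V(3)]
  proof (elim disjE bexE)
    fix b assume b: "b \<in> B" "z = c b"
    then have "y = z \<or> anc t y b" using xyz by (simp add: anc_leaf)
    then show ?thesis using anc_mid_trans[of b t x y] xyz b by (auto simp: anc_leaf)
  qed (use anc_mid_trans xyz in blast)
  show "anc t x y \<or> anc t y x" if xyz: "anc t x z" "anc t y z"
    using core_or_leaf[OF V(3)]
  proof (elim disjE bexE)
    fix b assume b: "b \<in> B" "z = c b"
    then have "x = z \<or> anc t x b" "y = z \<or> anc t y b" using xyz by (simp_all add: anc_leaf)
    then show ?thesis using anc_mid_chain[of b t x y] xyz b by auto
  qed (use anc_mid_chain xyz in blast)
qed

section \<open>Upper and lower bounds on the weighted depth\<close>

lemma decomposition_of_order:
  assumes "fo.parent_map t F"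
  shows "treedepth_decomposition V E F" "weighted_depth V w F = Max (fo.height t ` V)"
proof -
  note F = fo.forest_of_order[OF assms]
  have "(u, v) \<in> (parent_rel F)\<^sup>+ \<or> (v, u) \<in> (parent_rel F)\<^sup>+" if uv: "{u, v} \<in> E" for u v
  proof -
    obtain b where b: "b \<in> B" "{u, v} = {a, b} \<or> {u, v} = {b, c b}"
      using uv unfolding E_eq by blast
    \<comment> \<open>On whichever side of the centre \<open>b\<close> is placed, the two stay
      comparable.\<close>
    have "anc t a b \<or> anc t b a" "anc t b (c b)"
      using b(1) by (cases "b \<in> above t"; simp add: anc_centre anc_below anc_leaf fo.refl)+
    moreover have "u = a \<and> v = b \<or> u = b \<and> v = a \<or> u = b \<and> v = c b \<or> u = c b \<and> v = b"
      using b(2) unfolding doubleton_eq_iff by blast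
    ultimately have "u \<in> V" "v \<in> V" "u \<noteq> v" "anc t u v \<or> anc t v u"
      using b(1) by auto
    then have "(u, v) \<in> (parent_rel F)\<^sup>* \<or> (v, u) \<in> (parent_rel F)\<^sup>*"
      using F(2)[of v u] F(2)[of u v] by blast
    then show ?thesis using \<open>u \<noteq> v\<close> by (auto dest: rtranclD)
  qed
  then show "treedepth_decomposition V E F"
    using F(1) by (simp add: treedepth_decomposition_def)
  have "depth_of V w F v = fo.height t v" if "v \<in> V" for v
    unfolding depth_of_def fo.height_def using F(2)[OF that] by (intro sum.cong) auto
  then have "depth_of V w F ` V = fo.height t ` V" by (rule image_cong[OF refl])
  moreover have "V \<noteq> {}" using in_V(1) by blast
  ultimately show "weighted_depth V w F = Max (fo.height t ` V)"
    using weighted_depth_eq[OF F(1), of w] by simp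
qed

text \<open>The witness is a heaviest branch whose middle vertex \<open>G\<close> does not place
  above the centre. As \<open>G\<close> is arbitrary, it may place a leaf above its middle vertex;
  so from each edge only the comparability of its ends is taken.\<close>

lemma height_le_weighted_depth:
  assumes G: "treedepth_decomposition V E G"
  shows "\<exists>x\<in>V. \<forall>v\<in>V. fo.height (threshold x) v \<le> weighted_depth V w G"
proof -
  define K where "K = weighted_depth V w G"
  define le where "le u v \<longleftrightarrow> (u, v) \<in> (parent_rel G)\<^sup>*" for u v
  have forest: "rooted_forest V G" using G by (simp add: treedepth_decomposition_def)
  have le_refl: "le v v" for v by (simp add: le_def)
  have le_trans: "le x y \<Longrightarrow> le y z \<Longrightarrow> le x z" for x y z by (simp add: le_def)
  have le_chain: "le x z \<Longrightarrow> le y z \<Longrightarrow> le x y \<or> le y x" for x y z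
    unfolding le_def by (rule ancestors_chain)
  have edge: "le u v \<or> le v u" if "{u, v} \<in> E" for u v
    using G that unfolding treedepth_decomposition_def le_def by (meson trancl_into_rtrancl)
  have ab: "le a b \<or> le b a" if "b \<in> B" for b
    using that by (intro edge) (simp add: E_eq)
  have bc: "le b (c b) \<or> le (c b) b" if "b \<in> B" for b
    using that by (intro edge) (simp add: E_eq)
  \<comment> \<open>Vertices above a common vertex lie on one root path.\<close>
  have bound: "sum w A \<le> K" if "v \<in> V" "\<And>u. u \<in> A \<Longrightarrow> le u v" for A v
  proof -
    have "A \<subseteq> {u. u \<in> V \<and> (u, v) \<in> (parent_rel G)\<^sup>*}"
      using that ancestor_in[OF forest] by (auto simp: le_def)
    then have "sum w A \<le> depth_of V w G v"
      unfolding depth_of_def using fin_V by (intro sum_mono2) auto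
    also have "\<dots> \<le> Max (depth_of V w G ` V)"
      using that fin_V by (intro Max_ge) auto
    also have "Max (depth_of V w G ` V) = K"
      unfolding K_def using weighted_depth_eq[OF forest, of w] in_V(1) by (metis empty_iff)
    finally show ?thesis .
  qed
  define S where "S = {b \<in> B. le b a}"
  \<comment> \<open>If every middle vertex is in \<open>S\<close>, the centre is chosen, with
    threshold 0.\<close>
  obtain x where x: "x \<in> V" "x \<in> B \<Longrightarrow> x \<notin> S" "\<And>b. b \<in> B \<Longrightarrow> b \<notin> S \<Longrightarrow> x \<in> B \<and> tail b \<le> tail x"
  proof (cases "B - S = {}")
    case True
    then show ?thesis using that[of a] by auto
  next
    case False
    then have "Max (tail ` (B - S)) \<in> tail ` (B - S)" using fin_B by (intro Max_in) auto
    then obtain x where "x \<in> B - S" "tail x = Max (tail ` (B - S))" by auto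
    then show ?thesis using that[of x] fin_B by auto
  qed
  define t where "t = threshold x"
  have tail_pos: "0 < tail b" if "b \<in> B" for b
    using w_pos[of b] that by (simp add: tail_def)
  \<comment> \<open>By maximality of \<open>tail x\<close> outside \<open>S\<close>, only members of
    \<open>S\<close> exceed the threshold.\<close>
  have sub: "above t \<subseteq> S"
  proof
    fix b assume b: "b \<in> above t"
    show "b \<in> S"
    proof (rule ccontr)
      assume "b \<notin> S"
      then have "x \<in> B \<and> tail b \<le> tail x" using x(3) above_B[OF b] by blast
      then show False using b by (simp add: above_def t_def threshold_def)
    qed
  qed
  have fin_above: "finite (above t)" using fin_B by (simp add: above_def)
  have height_le: "fo.height t v \<le> sum w A" if "finite A" "{u. u \<in> V \<and> anc t u v} \<subseteq> A" for v A
    unfolding fo.height_def using that by (intro sum_mono2) auto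
  have leaf: "fo.height t (c b) \<le> K" if b: "b \<in> B" for b
  proof (cases "b \<in> above t")
    case True
    define P where "P = {u \<in> above t. before u b}"
    have P: "finite P" "b \<in> P" "P \<subseteq> above t"
      using True fin_above by (auto simp: P_def before_def)
    have le_a: "le u a" if "u \<in> P" for u using that P(3) sub by (auto simp: S_def)
    \<comment> \<open>The lowest vertex of \<open>P\<close> in \<open>G\<close>; it exists because
      all of \<open>P\<close> lies above the centre and so forms a chain.\<close>
    obtain l where l: "l \<in> P" "\<And>u. u \<in> P \<Longrightarrow> le u l"
    proof -
      have "\<exists>l\<in>Q. \<forall>u\<in>Q. le u l" if "finite Q" "Q \<noteq> {}" "\<And>u. u \<in> Q \<Longrightarrow> le u a" for Q
        using that
      proof (induction rule: finite_ne_induct)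
        case (singleton q)
        then show ?case by (simp add: le_refl)
      next
        case (insert q Q)
        then obtain l where "l \<in> Q" "\<forall>u\<in>Q. le u l" by auto
        moreover from this(1) have "le q l \<or> le l q" using le_chain[of q a l] insert.prems by auto
        ultimately show ?case using le_refl le_trans by (metis insert_iff)
      qed
      then show ?thesis using that P le_a by (metis empty_iff)
    qed
    have lB: "l \<in> B" using l P above_B by blast
    \<comment> \<open>The lower of \<open>l\<close> and its leaf, in whichever order
      \<open>G\<close> places them.\<close>
    obtain v where v: "v \<in> V" "le l v" "le (c l) v"
      using bc[OF lB] le_refl lB in_V(2,3) by metis
    have notin: "c l \<notin> P" "c b \<notin> P" using above_simps(2)[of _ t] lB b P(3) by blast+
    have "fo.height t (c b) \<le> sum w (insert (c b) P)"
      using P b True by (intro height_le) (auto simp: anc_leaf anc_above P_def)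
    \<comment> \<open>Jackson's rule enters here: \<open>l\<close> equals or precedes
      \<open>b\<close>, so its leaf is at least as heavy.\<close>
    also have "\<dots> \<le> sum w (insert (c l) P)"
      using l(1) P(1) notin by (auto simp: P_def before_def)
    also have "\<dots> \<le> K"
      using v l(2) le_trans by (intro bound[of v]) blast+
    finally show ?thesis .
  next
    case False
    then have "tail b \<le> t" using b by (simp add: above_def)
    \<comment> \<open>Positive tails exclude the default threshold 0, so the threshold comes from a
      branch that \<open>G\<close> keeps below the centre.\<close>
    then have xB: "x \<in> B" "t = tail x" and "x \<notin> S"
      using tail_pos[OF b] x(2) by (auto simp: t_def threshold_def split: if_splits)
    then have "le a x" using ab[of x] by (auto simp: S_def)
    obtain v where v: "v \<in> V" "le x v" "le (c x) v"
      using bc[OF xB(1)] le_refl xB(1) in_V(2,3) by metis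
    have "x \<notin> above t" using xB by (simp add: above_def)
    have "fo.height t (c b) \<le> sum w (insert (c b) (insert b (insert a (above t))))"
      using fin_above b False by (intro height_le) (auto simp: anc_leaf anc_below)
    also have "\<dots> = tail b + sum w (insert a (above t))"
      using b False fin_above by (simp add: tail_def)
    also have "\<dots> \<le> tail x + sum w (insert a (above t))"
      using \<open>tail b \<le> t\<close> xB by simp
    also have "\<dots> = sum w (insert (c x) (insert x (insert a (above t))))"
      using xB(1) \<open>x \<notin> above t\<close> fin_above by (simp add: tail_def)
    also have "\<dots> \<le> K"
    proof (rule bound[OF v(1)])
      fix u assume "u \<in> insert (c x) (insert x (insert a (above t)))"
      then have "u = c x \<or> u = x \<or> le u a" using sub le_refl by (auto simp: S_def)
      then show "le u v" using v \<open>le a x\<close> le_trans by blast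
    qed
    finally show ?thesis .
  qed
  have "fo.height t v \<le> K" if v: "v \<in> V" for v
    using v
  proof (cases rule: V_cases)
    case centre
    have "fo.height t v \<le> sum w (insert a (above t))"
      using centre fin_above by (intro height_le) (auto simp: anc_centre)
    also have "\<dots> \<le> K"
      using sub by (intro bound[of a]) (auto simp: le_refl S_def)
    finally show ?thesis .
  next
    case mid
    then have "fo.height t v \<le> fo.height t (c v)"
      unfolding fo.height_def using fin_V by (intro sum_mono2) (auto simp: anc_leaf)
    then show ?thesis using leaf[OF mid] by simp
  next
    case (leaf b)
    then show ?thesis using \<open>\<And>b. b \<in> B \<Longrightarrow> fo.height t (c b) \<le> K\<close> by simp
  qed
  then show ?thesis using x(1) unfolding K_def t_def by blast
qed

lemma wtd_eq:
  assumes x: "x \<in> V"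
    and best: "\<And>y. y \<in> V \<Longrightarrow> Max (fo.height (threshold x) ` V) \<le> Max (fo.height (threshold y) ` V)"
  shows "wtd V E w = Max (fo.height (threshold x) ` V)"
  unfolding wtd_def
proof (rule Least_equality)
  show "\<exists>F. treedepth_decomposition V E F \<and> weighted_depth V w F = Max (fo.height (threshold x) ` V)"
    using fo.parent_map_exists decomposition_of_order by blast
next
  fix d assume "\<exists>G. treedepth_decomposition V E G \<and> weighted_depth V w G = d"
  then obtain G where G: "treedepth_decomposition V E G" "weighted_depth V w G = d" by blast
  obtain y where y: "y \<in> V" "\<And>v. v \<in> V \<Longrightarrow> fo.height (threshold y) v \<le> d"
    using height_le_weighted_depth[OF G(1)] G(2) by blast
  have "Max (fo.height (threshold x) ` V) \<le> Max (fo.height (threshold y) ` V)"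
    by (rule best[OF y(1)])
  also have "\<dots> \<le> d"
    using y fin_V in_V(1) by (intro Max.boundedI) auto
  finally show "Max (fo.height (threshold x) ` V) \<le> d" .
qed

end

section \<open>Recognising the centre\<close>

definition vertex_degree :: "'a set \<Rightarrow> 'a set set \<Rightarrow> 'a \<Rightarrow> nat" where
  "vertex_degree V E u = card {v \<in> V. {u, v} \<in> E}"

text \<open>Middle vertices have degree 2 and are adjacent to the centre, leaves have degree 1 and
  are not. The degree of the candidate itself is no guide: with one branch it is that of a leaf,
  with two branches that of a middle vertex.\<close>

definition centre_like :: "'a set \<Rightarrow> 'a set set \<Rightarrow> 'a \<Rightarrow> bool" where
  "centre_like V E a \<longleftrightarrow>
     (\<forall>u\<in>V. u \<noteq> a \<longrightarrow> vertex_degree V E u = 1 + (if {a, u} \<in> E then 1 else 0))"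

context subdivided
begin

lemma edge_centre: "{a, v} \<in> E \<longleftrightarrow> v \<in> B"
  unfolding E_eq by (auto simp: doubleton_eq_iff)

lemma edge_mid: "b \<in> B \<Longrightarrow> {b, v} \<in> E \<longleftrightarrow> v = a \<or> v = c b"
  unfolding E_eq by (auto simp: doubleton_eq_iff)

lemma edge_leaf: "b \<in> B \<Longrightarrow> {c b, v} \<in> E \<longleftrightarrow> v = b"
  unfolding E_eq by (auto simp: doubleton_eq_iff)

lemma degree_centre: "vertex_degree V E a = card B"
  unfolding vertex_degree_def edge_centre by (rule arg_cong[of _ _ card]) auto

lemma degree_mid:
  assumes "b \<in> B"
  shows "vertex_degree V E b = 2"
proof -
  have "{v \<in> V. {b, v} \<in> E} = {a, c b}" using assms by (auto simp: edge_mid)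
  then show ?thesis using assms by (simp add: vertex_degree_def)
qed

lemma degree_leaf:
  assumes "b \<in> B"
  shows "vertex_degree V E (c b) = 1"
proof -
  have "{v \<in> V. {c b, v} \<in> E} = {b}" using assms by (auto simp: edge_leaf)
  then show ?thesis by (simp add: vertex_degree_def)
qed

lemma centre_like_centre: "centre_like V E a"
  unfolding centre_like_def
proof (intro ballI impI)
  fix u assume "u \<in> V" "u \<noteq> a"
  then show "vertex_degree V E u = 1 + (if {a, u} \<in> E then 1 else 0)"
    by (cases rule: V_cases) (auto simp: degree_mid degree_leaf edge_centre)
qed

text \<open>A path with three vertices is a subdivided star with respect to either of its ends.\<close>

lemma centre_like_imp_centre:
  assumes "v \<in> V" "centre_like V E v"
  shows "\<exists>B c. subdivided V E w v B c"
  using assms(1)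
proof (cases rule: V_cases)
  case centre
  then show ?thesis using subdivided_axioms by blast
next
  case mid
  \<comment> \<open>The leaf \<open>c v\<close> is adjacent to the middle vertex \<open>v\<close>
    but does not have degree 2.\<close>
  then show ?thesis
    using assms(2)[unfolded centre_like_def, rule_format, of "c v"] degree_leaf[OF mid]
    by (simp add: mid edge_mid)
next
  case (leaf b)
  \<comment> \<open>The old centre is not adjacent to a leaf, so it has degree 1; hence there is one
    branch, and its two ends exchange roles.\<close>
  then have "vertex_degree V E a = 1"
    using assms(2)[unfolded centre_like_def, rule_format, of a] by (simp add: edge_leaf)
  then have "B = {b}" using leaf(1) by (auto simp: degree_centre card_1_singleton_iff)
  then have "subdivided V E w v {b} (\<lambda>_. a)"
    using leaf w_pos unfolding V_eq E_eq by unfold_locales auto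
  then show ?thesis by blast
qed

text \<open>The leaf is the only neighbour of \<open>b\<close> besides the centre, so its weight can
  be found without locating it.\<close>

lemma leaf_weight_eq:
  assumes "b \<in> B"
  shows "(\<Sum>u\<in>V. if u = a then 0 else if {b, u} \<in> E then w u else 0) = w (c b)"
proof -
  have "(\<Sum>u\<in>V. if u = a then 0 else if {b, u} \<in> E then w u else 0) = (\<Sum>u\<in>V. if u = c b then w u else 0)"
    using assms by (intro sum.cong) (auto simp: edge_mid)
  then show ?thesis using assms fin_V by simp
qed

end

lemma subdivided_star_imp_subdivided:
  fixes V :: "'a::linorder set"
  assumes star: "subdivided_star V E" and w: "\<And>v. v \<in> V \<Longrightarrow> 0 < w v"
  shows "\<exists>a B c. subdivided V E w a B c"
proof -
  obtain m :: nat and a b c where inj: "inj_on b {1..m}" "inj_on c {1..m}"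
    and disj: "a \<notin> b ` {1..m}" "a \<notin> c ` {1..m}" "b ` {1..m} \<inter> c ` {1..m} = {}"
    and V: "V = {a} \<union> b ` {1..m} \<union> c ` {1..m}"
    and E: "E = (\<lambda>i. {a, b i}) ` {1..m} \<union> (\<lambda>i. {b i, c i}) ` {1..m}"
    using star unfolding subdivided_star_def by blast
  define f where "f = c \<circ> the_inv_into {1..m} b"
  have f: "f (b i) = c i" if "i \<in> {1..m}" for i
    using inj that by (simp add: f_def the_inv_into_f_f)
  have img: "f ` b ` {1..m} = c ` {1..m}"
    unfolding image_image by (rule image_cong) (auto simp: f)
  have "(\<lambda>i. {b i, f (b i)}) ` {1..m} = (\<lambda>i. {b i, c i}) ` {1..m}"
    by (rule image_cong) (auto simp: f)
  then have E': "E = (\<lambda>b. {a, b}) ` b ` {1..m} \<union> (\<lambda>b. {b, f b}) ` b ` {1..m}"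
    unfolding E image_image by simp
  have "inj_on f (b ` {1..m})"
    unfolding inj_on_def using inj(2) f by (auto dest: inj_onD)
  moreover have "V = insert a (b ` {1..m} \<union> f ` b ` {1..m})"
    unfolding V img by simp
  ultimately have "subdivided V E w a (b ` {1..m}) f"
    using disj w E' by (intro subdivided.intro) (simp_all only: img finite_imageI finite_atLeastAtMost not_False_eq_True)
  then show ?thesis by blast
qed

section \<open>Expressions for the optimal decomposition\<close>

text \<open>Loops cannot stop early, so the last hit is kept; the initial 0 is a junk value if there
  is none.\<close>

definition last_such :: "nat \<Rightarrow> (nat \<Rightarrow> bool) \<Rightarrow> nat" where
  "last_such n P = fold (\<lambda>i s. if P i then i else s) [0..<n] 0"

lemma last_such:
  assumes "i < n" "P i"
  shows "last_such n P < n" "P (last_such n P)"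
proof -
  have "(\<exists>i<n. P i) \<longrightarrow> last_such n P < n \<and> P (last_such n P)"
    by (induction n) (auto simp: last_such_def less_Suc_eq)
  then show "last_such n P < n" "P (last_such n P)" using assms by blast+
qed

text \<open>The shift by one keeps 0 free for failure, as in the output format for parents.\<close>

lemma fold_last_Suc:
  "(\<exists>z<n. fold (\<lambda>z s. if P z then Suc z else s) [0..<n] 0 = Suc z \<and> P z) \<or>
    fold (\<lambda>z s. if P z then Suc z else s) [0..<n] 0 = 0 \<and> (\<forall>z<n. \<not> P z)"
proof (induction n)
  case (Suc n)
  then show ?case by (cases "P n") (auto simp: less_Suc_eq)
qed simp

text \<open>Formulas are expressions; the value \<open>0\<close> means truth.\<close>

definition eq_exp :: "exp \<Rightarrow> exp \<Rightarrow> exp" where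
  "eq_exp e f = Plus (Minus e f) (Minus f e)"

definition not_exp :: "exp \<Rightarrow> exp" where
  "not_exp e = Ifz e (Num 1) (Num 0)"

definition sum_exp :: "nat \<Rightarrow> exp \<Rightarrow> exp" where
  "sum_exp x e = Loop x (Num 0) (Plus (Var x) e)"

text \<open>With truncated subtraction, \<open>s + (e - s)\<close> is the maximum of
  \<open>s\<close> and \<open>e\<close>.\<close>

definition max_exp :: "nat \<Rightarrow> exp \<Rightarrow> exp" where
  "max_exp x e = Loop x (Num 0) (Plus (Var x) (Minus e (Var x)))"

definition find_exp :: "nat \<Rightarrow> exp \<Rightarrow> exp" where
  "find_exp x e = Loop x (Num 0) (Ifz e (Var (Suc x)) (Var x))"

lemma eval_eq_exp [simp]: "eval (eq_exp e f) \<rho> M = 0 \<longleftrightarrow> eval e \<rho> M = eval f \<rho> M"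
  by (auto simp: eq_exp_def)

lemma eval_not_exp [simp]: "eval (not_exp e) \<rho> M = 0 \<longleftrightarrow> eval e \<rho> M \<noteq> 0"
  by (simp add: not_exp_def)

lemma fold_upt_cong:
  "(\<And>i s. i < n \<Longrightarrow> f i s = g i s) \<Longrightarrow> fold f [0..<n] s = fold g [0..<n] s"
  by (rule fold_cong) auto

lemma eval_sum_exp:
  assumes "\<rho> 0 = n" "\<And>i s. i < n \<Longrightarrow> eval e (\<rho>(x := s, Suc x := i)) M = f i"
  shows "eval (sum_exp x e) \<rho> M = (\<Sum>i<n. f i)"
proof -
  have "eval (sum_exp x e) \<rho> M = fold (\<lambda>i s. s + f i) [0..<n] 0"
    unfolding sum_exp_def eval.simps assms(1) using assms(2) by (intro fold_upt_cong) simp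
  also have "\<dots> = (\<Sum>i<n. f i)" by (induction n) auto
  finally show ?thesis .
qed

text \<open>As 0 means truth, a sum acts as a bounded universal quantifier. Only the vanishing of
  the body is prescribed, so falsity may be any positive value.\<close>

lemma eval_all_exp:
  assumes "\<rho> 0 = n" "\<And>i s. i < n \<Longrightarrow> eval e (\<rho>(x := s, Suc x := i)) M = 0 \<longleftrightarrow> P i"
  shows "eval (sum_exp x e) \<rho> M = 0 \<longleftrightarrow> (\<forall>i<n. P i)"
proof -
  have "fold (\<lambda>i s. eval (Plus (Var x) e) (\<rho>(x := s, Suc x := i)) M) [0..<m] 0 = 0 \<longleftrightarrow> (\<forall>i<m. P i)"
    if "m \<le> n" for m
    using that by (induction m) (auto simp: assms(2) less_Suc_eq)
  from this[of n] show ?thesis by (simp add: sum_exp_def assms(1))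
qed

lemma eval_max_exp:
  assumes "\<rho> 0 = n" "0 < n" "\<And>i s. i < n \<Longrightarrow> eval e (\<rho>(x := s, Suc x := i)) M = f i"
  shows "eval (max_exp x e) \<rho> M = Max (f ` {..<n})"
proof -
  have "eval (max_exp x e) \<rho> M = fold (\<lambda>i s. max s (f i)) [0..<n] 0"
    unfolding max_exp_def eval.simps assms(1) using assms(3) by (intro fold_upt_cong) simp
  also have "\<dots> = Max (insert 0 (f ` {..<n}))"
  proof (induction n)
    case (Suc n)
    have "insert 0 (f ` {..<Suc n}) = insert (f n) (insert 0 (f ` {..<n}))" by (auto simp: less_Suc_eq)
    then have "Max (insert 0 (f ` {..<Suc n})) = max (f n) (Max (insert 0 (f ` {..<n})))"
      by (simp only: Max_insert finite_insert finite_imageI finite_lessThan insert_not_empty not_False_eq_True)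
    then show ?case using Suc.IH by (simp only: upt_Suc_append fold_append) (simp add: max.commute)
  qed simp
  also have "\<dots> = Max (f ` {..<n})"
    using assms(2) by (subst Max_insert) auto
  finally show ?thesis .
qed

lemma eval_find_exp:
  assumes "\<rho> 0 = n" "\<And>i s. i < n \<Longrightarrow> eval e (\<rho>(x := s, Suc x := i)) M = 0 \<longleftrightarrow> P i"
  shows "eval (find_exp x e) \<rho> M = last_such n P"
  unfolding find_exp_def last_such_def eval.simps assms(1) using assms(2)
  by (intro fold_upt_cong) simp

lemma wf_eq_exp [simp]: "wf_exp d (eq_exp e f) \<longleftrightarrow> wf_exp d e \<and> wf_exp d f"
  by (auto simp: eq_exp_def)

lemma wf_not_exp [simp]: "wf_exp d (not_exp e) \<longleftrightarrow> wf_exp d e"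
  by (simp add: not_exp_def)

lemma wf_sum_exp [simp]: "wf_exp d (sum_exp x e) \<longleftrightarrow> x = d \<and> wf_exp (Suc (Suc x)) e"
  by (simp add: sum_exp_def)

lemma wf_max_exp [simp]: "wf_exp d (max_exp x e) \<longleftrightarrow> x = d \<and> wf_exp (Suc (Suc x)) e"
  by (auto simp: max_exp_def)

lemma wf_find_exp [simp]: "wf_exp d (find_exp x e) \<longleftrightarrow> x = d \<and> wf_exp (Suc (Suc x)) e"
  by (auto simp: find_exp_def)

text \<open>Address 0 holds n, hence the offsets by \<open>Suc\<close>. Only the cells of the graph
  are constrained, so the property also holds with the extra input of the decision problem and
  survives writes behind the graph.\<close>

definition encodes :: "nat \<Rightarrow> nat set set \<Rightarrow> (nat \<Rightarrow> nat) \<Rightarrow> (nat \<Rightarrow> nat) \<Rightarrow> bool" where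
  "encodes n E w M \<longleftrightarrow> (\<forall>v<n. M (Suc v) = w v) \<and>
     (\<forall>u<n. \<forall>v<n. M (Suc (n + v + n * u)) = (if {u, v} \<in> E then 1 else 0))"

definition weight_exp :: "nat \<Rightarrow> exp" where
  "weight_exp v = Mem (Plus (Num 1) (Var v))"

text \<open>The machine cannot multiply, so the row offset is obtained by summing \<open>u\<close>
  over all n vertices.\<close>

definition adj_exp :: "nat \<Rightarrow> nat \<Rightarrow> nat \<Rightarrow> exp" where
  "adj_exp x u v = Mem (Plus (Num 1) (Plus (Plus (Var 0) (Var v)) (sum_exp x (Var u))))"

definition degree_exp :: "nat \<Rightarrow> nat \<Rightarrow> exp" where
  "degree_exp x u = sum_exp x (adj_exp (Suc (Suc x)) u (Suc x))"

definition centre_exp :: "nat \<Rightarrow> exp" where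
  "centre_exp x = find_exp x (sum_exp (x + 2) (Ifz (eq_exp (Var (x + 3)) (Var (x + 1))) (Num 0)
     (eq_exp (degree_exp (x + 4) (x + 3)) (Plus (Num 1) (adj_exp (x + 4) (x + 1) (x + 3))))))"

lemma eval_weight_exp [simp]:
  "encodes n E w M \<Longrightarrow> \<rho> v < n \<Longrightarrow> eval (weight_exp v) \<rho> M = w (\<rho> v)"
  by (simp add: weight_exp_def encodes_def)

lemma eval_adj_exp [simp]:
  assumes "encodes n E w M" "\<rho> 0 = n" "u < x" "v < x" "\<rho> u < n" "\<rho> v < n"
  shows "eval (adj_exp x u v) \<rho> M = (if {\<rho> u, \<rho> v} \<in> E then 1 else 0)"
proof -
  have "eval (sum_exp x (Var u)) \<rho> M = (\<Sum>i<n. \<rho> u)"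
    using assms by (intro eval_sum_exp) auto
  then show ?thesis using assms by (simp add: adj_exp_def encodes_def)
qed

lemma eval_degree_exp [simp]:
  assumes "encodes n E w M" "\<rho> 0 = n" "0 < x" "u < x" "\<rho> u < n"
  shows "eval (degree_exp x u) \<rho> M = vertex_degree {..<n} E (\<rho> u)"
proof -
  have "eval (degree_exp x u) \<rho> M = (\<Sum>i<n. if {\<rho> u, i} \<in> E then 1 else 0)"
    unfolding degree_exp_def using assms by (intro eval_sum_exp) auto
  also have "\<dots> = vertex_degree {..<n} E (\<rho> u)"
    unfolding vertex_degree_def by (subst sum.inter_filter[symmetric]) auto
  finally show ?thesis .
qed

lemma eval_centre_exp:
  assumes M: "encodes n E w M" and n: "\<rho> 0 = n" and x: "0 < x"
  shows "eval (centre_exp x) \<rho> M = last_such n (centre_like {..<n} E)"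
  unfolding centre_exp_def
proof (rule eval_find_exp[of \<rho>, OF n])
  fix i s assume i: "i < n"
  show "eval (sum_exp (x + 2) (Ifz (eq_exp (Var (x + 3)) (Var (x + 1))) (Num 0)
     (eq_exp (degree_exp (x + 4) (x + 3)) (Plus (Num 1) (adj_exp (x + 4) (x + 1) (x + 3))))))
     (\<rho>(x := s, Suc x := i)) M = 0 \<longleftrightarrow> centre_like {..<n} E i"
    using M n x i
    by (subst eval_all_exp[where n = n and
        P = "\<lambda>u. u \<noteq> i \<longrightarrow> vertex_degree {..<n} E u = 1 + (if {i, u} \<in> E then 1 else 0)"])
      (auto simp: centre_like_def)
qed

text \<open>Here and below, \<open>x\<close> is the first free variable, while \<open>i\<close>,
  \<open>t\<close>, \<open>j\<close>, \<open>k\<close> are the variables holding the centre, a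
  threshold and vertices. Matrix entries do not follow the truth convention: 0 means no
  edge.\<close>

definition leaf_exp :: "nat \<Rightarrow> nat \<Rightarrow> nat \<Rightarrow> exp" where
  "leaf_exp x i j = sum_exp x (Ifz (eq_exp (Var (Suc x)) (Var i)) (Num 0)
     (Ifz (adj_exp (Suc (Suc x)) j (Suc x)) (Num 0) (weight_exp (Suc x))))"

definition tail_exp :: "nat \<Rightarrow> nat \<Rightarrow> nat \<Rightarrow> exp" where
  "tail_exp x i j = Plus (weight_exp j) (leaf_exp x i j)"

definition threshold_exp :: "nat \<Rightarrow> nat \<Rightarrow> nat \<Rightarrow> exp" where
  "threshold_exp x i j = Ifz (adj_exp x i j) (Num 0) (tail_exp x i j)"

text \<open>By truncation, \<open>t + 1 - tail\<close> vanishes exactly for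
  \<open>t < tail\<close>.\<close>

definition above_exp :: "nat \<Rightarrow> nat \<Rightarrow> nat \<Rightarrow> nat \<Rightarrow> exp" where
  "above_exp x i t j =
     Ifz (adj_exp x i j) (Num 1) (Minus (Plus (Var t) (Num 1)) (tail_exp x i j))"

text \<open>A vertex that is neither the centre nor adjacent to it is a leaf, and its only neighbour
  is the middle vertex.\<close>

definition mid_exp :: "nat \<Rightarrow> nat \<Rightarrow> nat \<Rightarrow> exp" where
  "mid_exp x i j = Ifz (eq_exp (Var j) (Var i)) (Var j) (Ifz (adj_exp x i j)
     (find_exp x (Minus (Num 1) (adj_exp (Suc (Suc x)) j (Suc x)))) (Var j))"

text \<open>The first summand excludes a heavier leaf at \<open>k\<close>; given this, the test in
  the second succeeds exactly for equal leaf weights, where the vertex numbers decide.\<close>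

definition before_exp :: "nat \<Rightarrow> nat \<Rightarrow> nat \<Rightarrow> nat \<Rightarrow> exp" where
  "before_exp x i j k = Plus (Minus (leaf_exp x i k) (leaf_exp x i j))
     (Ifz (Minus (leaf_exp x i j) (leaf_exp x i k)) (Minus (Var j) (Var k)) (Num 0))"

definition anc_exp :: "nat \<Rightarrow> nat \<Rightarrow> nat \<Rightarrow> nat \<Rightarrow> nat \<Rightarrow> exp" where
  "anc_exp x i t j k = Bind x (mid_exp x i k)
     (Ifz (eq_exp (Var j) (Var k)) (Num 0)
     (Ifz (eq_exp (Var j) (Var x)) (Num 0)
     (Ifz (above_exp (Suc x) i t j)
        (Ifz (above_exp (Suc x) i t x) (before_exp (Suc x) i j x) (Num 0))
        (Plus (eq_exp (Var j) (Var i)) (not_exp (above_exp (Suc x) i t x))))))"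

definition height_exp :: "nat \<Rightarrow> nat \<Rightarrow> nat \<Rightarrow> nat \<Rightarrow> exp" where
  "height_exp x i t j =
     sum_exp x (Ifz (anc_exp (Suc (Suc x)) i t (Suc x) j) (weight_exp (Suc x)) (Num 0))"

definition depth_exp :: "nat \<Rightarrow> nat \<Rightarrow> nat \<Rightarrow> exp" where
  "depth_exp x i t = max_exp x (height_exp (Suc (Suc x)) i t (Suc x))"

text \<open>Candidate and rival are in \<open>x + 1\<close> and \<open>x + 3\<close>. Depths are
  recomputed for every pair, which only adds to the fixed nesting depth of the loops.\<close>

definition best_exp :: "nat \<Rightarrow> nat \<Rightarrow> exp" where
  "best_exp x i = find_exp x (sum_exp (x + 2)
     (Bind (x + 4) (threshold_exp (x + 4) i (x + 1))
     (Bind (x + 5) (threshold_exp (x + 5) i (x + 3))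
        (Minus (depth_exp (x + 6) i (x + 4)) (depth_exp (x + 6) i (x + 5))))))"

definition covers_exp :: "nat \<Rightarrow> nat \<Rightarrow> nat \<Rightarrow> nat \<Rightarrow> nat \<Rightarrow> exp" where
  "covers_exp x i t j k = Plus (not_exp (eq_exp (Var j) (Var k))) (Plus (anc_exp x i t j k)
     (eq_exp (Plus (height_exp x i t j) (weight_exp k)) (height_exp x i t k)))"

definition parent_exp :: "nat \<Rightarrow> nat \<Rightarrow> nat \<Rightarrow> nat \<Rightarrow> exp" where
  "parent_exp x i t k = Loop x (Num 0)
     (Ifz (covers_exp (Suc (Suc x)) i t (Suc x) k) (Plus (Var (Suc x)) (Num 1)) (Var x))"

section \<open>Correctness of the expressions\<close>

locale star_instance = subdivided "{..<n}" E w a B c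
  for n :: nat and E w a B c
begin

definition depth :: "nat \<Rightarrow> nat" where
  "depth t = Max (fo.height t ` {..<n})"

lemma less_n [simp]: "a < n" "b \<in> B \<Longrightarrow> b < n" "b \<in> B \<Longrightarrow> c b < n"
  using in_V by auto

lemma eval_leaf_exp [simp]:
  assumes "encodes n E w M" "\<rho> 0 = n" "0 < x" "i < x" "j < x" "\<rho> i = a" "\<rho> j \<in> B"
  shows "eval (leaf_exp x i j) \<rho> M = w (c (\<rho> j))"
proof -
  have "eval (leaf_exp x i j) \<rho> M = (\<Sum>u<n. if u = a then 0 else if {\<rho> j, u} \<in> E then w u else 0)"
    unfolding leaf_exp_def using assms by (intro eval_sum_exp) auto
  then show ?thesis using leaf_weight_eq[OF assms(7)] by simp
qed

lemma eval_tail_exp [simp]: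
  assumes "encodes n E w M" "\<rho> 0 = n" "0 < x" "i < x" "j < x" "\<rho> i = a" "\<rho> j \<in> B"
  shows "eval (tail_exp x i j) \<rho> M = tail (\<rho> j)"
  using assms by (simp add: tail_exp_def tail_def)

lemma eval_adj_centre:
  assumes "encodes n E w M" "\<rho> 0 = n" "0 < x" "i < x" "j < x" "\<rho> i = a" "\<rho> j < n"
  shows "eval (adj_exp x i j) \<rho> M = (if \<rho> j \<in> B then 1 else 0)"
  using assms by (simp add: edge_centre)

lemma eval_threshold_exp [simp]:
  assumes "encodes n E w M" "\<rho> 0 = n" "0 < x" "i < x" "j < x" "\<rho> i = a" "\<rho> j < n"
  shows "eval (threshold_exp x i j) \<rho> M = threshold (\<rho> j)"
  using assms by (simp add: threshold_exp_def threshold_def eval_adj_centre del: eval_adj_exp)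

lemma eval_above_exp [simp]:
  assumes "encodes n E w M" "\<rho> 0 = n" "0 < x" "i < x" "j < x" "t < x" "\<rho> i = a" "\<rho> j < n"
  shows "eval (above_exp x i t j) \<rho> M = 0 \<longleftrightarrow> \<rho> j \<in> above (\<rho> t)"
  using assms by (auto simp: above_exp_def above_def eval_adj_centre simp del: eval_adj_exp)

lemma eval_mid_exp [simp]:
  assumes "encodes n E w M" "\<rho> 0 = n" "0 < x" "i < x" "j < x" "\<rho> i = a" "\<rho> j < n"
  shows "eval (mid_exp x i j) \<rho> M = mid (\<rho> j)"
proof -
  have "\<rho> j \<in> {..<n}" using assms by simp
  then show ?thesis
  proof (cases rule: V_cases)
    case (leaf b)
    have "eval (find_exp x (Minus (Num 1) (adj_exp (Suc (Suc x)) j (Suc x)))) \<rho> M =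
        last_such n (\<lambda>u. u = b)"
      using assms leaf by (intro eval_find_exp) (auto simp: edge_leaf)
    also have "\<dots> = b" using last_such(2)[of b n "\<lambda>u. u = b"] leaf by simp
    finally show ?thesis using assms leaf
      by (simp add: mid_exp_def eval_adj_centre del: eval_adj_exp)
  qed (use assms in \<open>simp_all add: mid_exp_def eval_adj_centre del: eval_adj_exp\<close>)
qed

lemma mid_less: "v < n \<Longrightarrow> mid v < n"
  using V_cases[of v "mid v < n"] by auto

lemma eval_before_exp [simp]:
  assumes "encodes n E w M" "\<rho> 0 = n" "0 < x" "i < x" "j < x" "k < x" "\<rho> i = a"
    "\<rho> j \<in> B" "\<rho> k \<in> B"
  shows "eval (before_exp x i j k) \<rho> M = 0 \<longleftrightarrow> before (\<rho> j) (\<rho> k)"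
  using assms by (auto simp: before_exp_def before_def)

text \<open>\<open>before_exp\<close> is meaningful for middle vertices only; it is reached after
  both membership tests have succeeded.\<close>

lemma eval_anc_exp [simp]:
  assumes "encodes n E w M" "\<rho> 0 = n" "0 < x" "i < x" "j < x" "k < x" "t < x" "\<rho> i = a"
    "\<rho> j < n" "\<rho> k < n"
  shows "eval (anc_exp x i t j k) \<rho> M = 0 \<longleftrightarrow> anc (\<rho> t) (\<rho> j) (\<rho> k)"
  using assms mid_less[of "\<rho> k"] above_B[of "\<rho> j" "\<rho> t"] above_B[of "mid (\<rho> k)" "\<rho> t"]
  by (simp add: anc_exp_def anc_def)

lemma eval_height_exp [simp]:
  assumes "encodes n E w M" "\<rho> 0 = n" "0 < x" "i < x" "j < x" "t < x" "\<rho> i = a" "\<rho> j < n"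
  shows "eval (height_exp x i t j) \<rho> M = fo.height (\<rho> t) (\<rho> j)"
proof -
  have "eval (height_exp x i t j) \<rho> M = (\<Sum>u<n. if anc (\<rho> t) u (\<rho> j) then w u else 0)"
    unfolding height_exp_def using assms by (intro eval_sum_exp) auto
  also have "\<dots> = fo.height (\<rho> t) (\<rho> j)"
    unfolding fo.height_def by (subst sum.inter_filter[symmetric]) auto
  finally show ?thesis .
qed

lemma eval_depth_exp [simp]:
  assumes "encodes n E w M" "\<rho> 0 = n" "0 < x" "i < x" "t < x" "\<rho> i = a"
  shows "eval (depth_exp x i t) \<rho> M = depth (\<rho> t)"
proof -
  have "0 < n" using less_n(1) by linarith
  then show ?thesis unfolding depth_exp_def depth_def using assms by (intro eval_max_exp) auto
qed

definition best :: nat where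
  "best = last_such n (\<lambda>x. \<forall>y<n. depth (threshold x) \<le> depth (threshold y))"

lemma eval_best_exp [simp]:
  assumes "encodes n E w M" "\<rho> 0 = n" "0 < x" "i < x" "\<rho> i = a"
  shows "eval (best_exp x i) \<rho> M = best"
  unfolding best_exp_def best_def
proof (rule eval_find_exp[of \<rho>, OF assms(2)])
  fix u s assume "u < n"
  then show "eval (sum_exp (x + 2)
     (Bind (x + 4) (threshold_exp (x + 4) i (x + 1))
     (Bind (x + 5) (threshold_exp (x + 5) i (x + 3))
        (Minus (depth_exp (x + 6) i (x + 4)) (depth_exp (x + 6) i (x + 5))))))
     (\<rho>(x := s, Suc x := u)) M = 0 \<longleftrightarrow> (\<forall>y<n. depth (threshold u) \<le> depth (threshold y))"
    using assms by (intro eval_all_exp) auto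
qed

lemma eval_covers_exp [simp]:
  assumes "encodes n E w M" "\<rho> 0 = n" "0 < x" "i < x" "j < x" "k < x" "t < x" "\<rho> i = a"
    "\<rho> j < n" "\<rho> k < n"
  shows "eval (covers_exp x i t j k) \<rho> M = 0 \<longleftrightarrow> fo.covers (\<rho> t) (\<rho> j) (\<rho> k)"
  using assms by (simp add: covers_exp_def fo.covers_def)

definition parent_code :: "nat \<Rightarrow> nat \<Rightarrow> nat" where
  "parent_code t v = fold (\<lambda>z s. if fo.covers t z v then Suc z else s) [0..<n] 0"

lemma parent_code_cases:
  "(\<exists>z<n. parent_code t v = Suc z \<and> fo.covers t z v) \<or>
    parent_code t v = 0 \<and> (\<forall>z<n. \<not> fo.covers t z v)"
  unfolding parent_code_def by (rule fold_last_Suc)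

lemma eval_parent_exp [simp]:
  assumes "encodes n E w M" "\<rho> 0 = n" "0 < x" "i < x" "k < x" "t < x" "\<rho> i = a" "\<rho> k < n"
  shows "eval (parent_exp x i t k) \<rho> M = parent_code (\<rho> t) (\<rho> k)"
  unfolding parent_exp_def parent_code_def eval.simps assms(2)
  using assms by (intro fold_upt_cong) simp

end

section \<open>The two programs\<close>

lemma wf_weight_exp [simp]: "wf_exp d (weight_exp v) \<longleftrightarrow> v < d"
  by (simp add: weight_exp_def)

lemma wf_adj_exp [simp]:
  "x = d \<Longrightarrow> 0 < d \<Longrightarrow> u < d \<Longrightarrow> v < d \<Longrightarrow> wf_exp d (adj_exp x u v)"
  by (simp add: adj_exp_def)

lemma wf_centre_exp [simp]: "x = d \<Longrightarrow> 0 < d \<Longrightarrow> wf_exp d (centre_exp x)"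
  by (simp add: centre_exp_def degree_exp_def)

lemma wf_tail_exp [simp]:
  "x = d \<Longrightarrow> 0 < d \<Longrightarrow> i < d \<Longrightarrow> j < d \<Longrightarrow> wf_exp d (leaf_exp x i j)"
  "x = d \<Longrightarrow> 0 < d \<Longrightarrow> i < d \<Longrightarrow> j < d \<Longrightarrow> wf_exp d (tail_exp x i j)"
  "x = d \<Longrightarrow> 0 < d \<Longrightarrow> i < d \<Longrightarrow> j < d \<Longrightarrow> wf_exp d (threshold_exp x i j)"
  "x = d \<Longrightarrow> 0 < d \<Longrightarrow> i < d \<Longrightarrow> j < d \<Longrightarrow> t < d \<Longrightarrow> wf_exp d (above_exp x i t j)"
  "x = d \<Longrightarrow> 0 < d \<Longrightarrow> i < d \<Longrightarrow> j < d \<Longrightarrow> wf_exp d (mid_exp x i j)"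
  "x = d \<Longrightarrow> 0 < d \<Longrightarrow> i < d \<Longrightarrow> j < d \<Longrightarrow> k < d \<Longrightarrow> wf_exp d (before_exp x i j k)"
  by (simp_all add: leaf_exp_def tail_exp_def threshold_exp_def above_exp_def mid_exp_def before_exp_def)

lemma wf_height_exp [simp]:
  "x = d \<Longrightarrow> 0 < d \<Longrightarrow> i < d \<Longrightarrow> t < d \<Longrightarrow> j < d \<Longrightarrow> k < d \<Longrightarrow> wf_exp d (anc_exp x i t j k)"
  "x = d \<Longrightarrow> 0 < d \<Longrightarrow> i < d \<Longrightarrow> t < d \<Longrightarrow> j < d \<Longrightarrow> wf_exp d (height_exp x i t j)"
  "x = d \<Longrightarrow> 0 < d \<Longrightarrow> i < d \<Longrightarrow> t < d \<Longrightarrow> wf_exp d (depth_exp x i t)"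
  by (simp_all add: anc_exp_def height_exp_def depth_exp_def)

lemma wf_best_exp [simp]: "x = d \<Longrightarrow> 0 < d \<Longrightarrow> i < d \<Longrightarrow> wf_exp d (best_exp x i)"
  by (simp add: best_exp_def)

lemma wf_parent_exp [simp]:
  "x = d \<Longrightarrow> 0 < d \<Longrightarrow> i < d \<Longrightarrow> t < d \<Longrightarrow> k < d \<Longrightarrow> wf_exp d (parent_exp x i t k)"
  by (simp add: parent_exp_def covers_exp_def)

text \<open>The length of the encoded graph and thus the first address behind it: the sign bit in
  the decision problem, free space in the other problem.\<close>

definition size_exp :: "nat \<Rightarrow> exp" where
  "size_exp x = Plus (Num 1) (Plus (Var 0) (sum_exp x (Var 0)))"

text \<open>Evaluates \<open>e\<close> with the centre in variable \<open>x\<close> and the optimal threshold in variable \<open>x + 2\<close>.\<close>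

definition optimal_exp :: "nat \<Rightarrow> exp \<Rightarrow> exp" where
  "optimal_exp x e = Bind x (centre_exp x) (Bind (x + 1) (best_exp (x + 1) x)
     (Bind (x + 2) (threshold_exp (x + 2) x (x + 1)) e))"

lemma eval_size_exp [simp]:
  assumes "\<rho> 0 = n" "0 < x"
  shows "eval (size_exp x) \<rho> M = Suc (n + n * n)"
proof -
  have "eval (sum_exp x (Var 0)) \<rho> M = (\<Sum>i<n. n)"
    using assms by (intro eval_sum_exp) auto
  then show ?thesis using assms by (simp add: size_exp_def)
qed

lemma wf_size_exp [simp]: "x = d \<Longrightarrow> 0 < d \<Longrightarrow> wf_exp d (size_exp x)"
  by (simp add: size_exp_def)

lemma wf_optimal_exp [simp]: "x = d \<Longrightarrow> 0 < d \<Longrightarrow> wf_exp (x + 3) e \<Longrightarrow> wf_exp d (optimal_exp x e)"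
  by (simp add: optimal_exp_def eval_nat_numeral)

text \<open>A nonzero sign bit means a negative bound, answered by 0 since depths are natural
  numbers. In the body of \<open>optimal_exp 1\<close> the centre is in variable 1 and the threshold
  in variable 3.\<close>

definition decision_cmd :: cmd where
  "decision_cmd = Write (Num 0) (Ifz (Mem (size_exp 1))
     (optimal_exp 1 (Ifz (Minus (depth_exp 4 1 3) (Mem (Plus (Num 1) (size_exp 4)))) (Num 1) (Num 0)))
     (Num 0))"

text \<open>The output occupies addresses 0 to n and would destroy input that is still to be read.
  So the parents and the depth are first written behind the graph and then copied down.\<close>

definition decomposition_cmd :: cmd where
  "decomposition_cmd =
     Seq (For 1 (Write (Plus (size_exp 2) (Var 1)) (optimal_exp 2 (parent_exp 5 2 4 1))))
    (Seq (Write (Plus (size_exp 1) (Var 0)) (optimal_exp 1 (depth_exp 4 1 3)))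
    (Seq (For 1 (Write (Plus (Num 1) (Var 1)) (Mem (Plus (size_exp 2) (Var 1)))))
         (Write (Num 0) (Mem (Plus (size_exp 1) (Var 0))))))"

lemma wf_decision_cmd: "wf_cmd 1 decision_cmd"
  by (simp add: decision_cmd_def)

lemma wf_decomposition_cmd: "wf_cmd 1 decomposition_cmd"
  by (simp add: decomposition_cmd_def)

section \<open>Layout of input and output in memory\<close>

lemma length_concat_map_upt: "length (concat (map (\<lambda>i. map (f i) [0..<k]) [0..<m])) = k * m"
  by (induction m) auto

lemma nth_concat_map_upt:
  "u < m \<Longrightarrow> v < k \<Longrightarrow> concat (map (\<lambda>i. map (f i) [0..<k]) [0..<m]) ! (v + k * u) = f u v"
proof (induction m)
  case (Suc m)
  show ?case
  proof (cases "u = m")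
    case True
    then show ?thesis using Suc.prems by (simp add: nth_append length_concat_map_upt)
  next
    case False
    then have u: "u < m" using Suc.prems by simp
    have "v + k * u < k * Suc u" using Suc.prems by simp
    also have "\<dots> \<le> k * m" using u by (intro mult_le_mono2) simp
    finally show ?thesis using Suc.IH[OF u Suc.prems(2)]
      by (simp add: nth_append length_concat_map_upt)
  qed
qed simp

lemma length_encode_graph [simp]: "length (encode_graph (n, E, w)) = Suc (n + n * n)"
  by (simp add: length_concat_map_upt)

lemma memory_append: "i < length xs \<Longrightarrow> memory (xs @ ys) i = xs ! i"
  by (simp add: memory_def nth_append)

lemma encode_graph_nth:
  "encode_graph (n, E, w) ! 0 = n"
  "v < n \<Longrightarrow> encode_graph (n, E, w) ! Suc v = w v"
  "u < n \<Longrightarrow> v < n \<Longrightarrow>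
    encode_graph (n, E, w) ! Suc (n + v + n * u) = (if {u, v} \<in> E then 1 else 0)"
  by (simp_all add: nth_append nth_concat_map_upt add.assoc)

lemma matrix_index_less:
  fixes n u v :: nat
  assumes "u < n" "v < n"
  shows "Suc (n + v + n * u) < Suc (n + n * n)"
proof -
  have "v + n * u < n * Suc u" using assms by simp
  also have "\<dots> \<le> n * n" using assms by (intro mult_le_mono2) simp
  finally show ?thesis by simp
qed

lemma encodes_memory: "encodes n E w (memory (encode_graph (n, E, w) @ ys))"
  unfolding encodes_def using matrix_index_less
  by (auto simp: memory_append encode_graph_nth simp del: encode_graph.simps)

lemma encodes_cong:
  assumes "encodes n E w M" "\<And>i. i < Suc (n + n * n) \<Longrightarrow> M' i = M i"
  shows "encodes n E w M'"
  using assms matrix_index_less unfolding encodes_def by auto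

text \<open>For loops whose round \<open>v\<close> fills the cell \<open>p + v\<close>:
  \<open>P\<close> is what the rounds require of the memory, and their writes have to preserve
  it.\<close>

lemma fold_write:
  fixes M :: "nat \<Rightarrow> 'a"
  assumes "\<And>v M. v < m \<Longrightarrow> P M \<Longrightarrow> f v M = M(p + v := g v)"
    and "\<And>v M y. v < m \<Longrightarrow> P M \<Longrightarrow> P (M(p + v := y))" and "P M"
  shows "fold f [0..<m] M = (\<lambda>i. if p \<le> i \<and> i < p + m then g (i - p) else M i)"
    and "P (fold f [0..<m] M)"
proof -
  have "fold f [0..<k] M = (\<lambda>i. if p \<le> i \<and> i < p + k then g (i - p) else M i) \<and> P (fold f [0..<k] M)"
    if "k \<le> m" for k
    using that
  proof (induction k)
    case (Suc k)
    have IH: "fold f [0..<k] M = (\<lambda>i. if p \<le> i \<and> i < p + k then g (i - p) else M i)"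
      "P (fold f [0..<k] M)" using Suc.IH Suc_leD[OF Suc.prems] by blast+
    have eq: "fold f [0..<Suc k] M = (fold f [0..<k] M)(p + k := g k)"
      using assms(1)[of k "fold f [0..<k] M"] IH(2) Suc.prems by simp
    then have "P (fold f [0..<Suc k] M)" using assms(2)[of k] IH(2) Suc.prems by simp
    moreover have "fold f [0..<Suc k] M = (\<lambda>i. if p \<le> i \<and> i < p + Suc k then g (i - p) else M i)"
      unfolding eq IH(1) by (auto simp: fun_eq_iff)
    ultimately show ?case by blast
  qed (use assms(3) in \<open>auto simp: fun_eq_iff\<close>)
  then show "fold f [0..<m] M = (\<lambda>i. if p \<le> i \<and> i < p + m then g (i - p) else M i)"
    "P (fold f [0..<m] M)" by blast+
qed

section \<open>Correctness of the two commands\<close>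

context star_instance
begin

lemma best_less: "best < n"
  and best_optimal: "y < n \<Longrightarrow> depth (threshold best) \<le> depth (threshold y)"
proof -
  have "\<exists>x<n. \<forall>y<n. depth (threshold x) \<le> depth (threshold y)"
  proof -
    have "{..<n} \<noteq> {}" using in_V(1) by blast
    then have "Min ((\<lambda>x. depth (threshold x)) ` {..<n}) \<in> (\<lambda>x. depth (threshold x)) ` {..<n}"
      by (intro Min_in) auto
    then obtain x where "x < n" "depth (threshold x) = Min ((\<lambda>x. depth (threshold x)) ` {..<n})"
      by auto
    then show ?thesis by (intro exI[of _ x]) auto
  qed
  then obtain x where x: "x < n" "\<forall>y<n. depth (threshold x) \<le> depth (threshold y)" by blast
  from last_such[of x n "\<lambda>x. \<forall>y<n. depth (threshold x) \<le> depth (threshold y)", OF x]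
  show "best < n" "y < n \<Longrightarrow> depth (threshold best) \<le> depth (threshold y)"
    by (auto simp: best_def)
qed

lemma wtd_eq_depth: "wtd {..<n} E w = depth (threshold best)"
  using wtd_eq[of best] best_less best_optimal unfolding depth_def by simp

text \<open>The first assumption ties the centre of the locale to the one found by the machine; on a
  path with three vertices there are two possible centres.\<close>

lemma eval_optimal_exp:
  assumes "a = last_such n (centre_like {..<n} E)" "encodes n E w M" "\<rho> 0 = n" "0 < x"
  shows "eval (optimal_exp x e) \<rho> M =
    eval e (\<rho>(x := a, x + 1 := best, x + 2 := threshold best)) M"
proof -
  have "eval (centre_exp x) \<rho> M = a" using assms by (simp add: eval_centre_exp)
  moreover have "eval (best_exp (x + 1) x) (\<rho>(x := a)) M = best"
    using assms(2-4) by (intro eval_best_exp) auto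
  moreover have "eval (threshold_exp (x + 2) x (x + 1)) (\<rho>(x := a, x + 1 := best)) M = threshold best"
    using assms(2-4) best_less by (subst eval_threshold_exp) auto
  ultimately show ?thesis by (simp add: optimal_exp_def)
qed

lemma run_decision_cmd:
  assumes a: "a = last_such n (centre_like {..<n} E)" and M: "encodes n E w M"
    and k: "M (Suc (n + n * n)) = (if k < 0 then 1 else 0)" "M (Suc (Suc (n + n * n))) = nat \<bar>k\<bar>"
  shows "weighted_treedepth_output ((n, E, w), k) (run decision_cmd ((\<lambda>_. 0)(0 := n)) M)"
proof -
  have "eval (optimal_exp 1 (Ifz (Minus (depth_exp 4 1 3) (Mem (Plus (Num 1) (size_exp 4)))) (Num 1) (Num 0)))
      ((\<lambda>_. 0)(0 := n)) M = (if wtd {..<n} E w \<le> nat \<bar>k\<bar> then 1 else 0)"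
    using a M k by (subst eval_optimal_exp) (auto simp: wtd_eq_depth)
  then have "run decision_cmd ((\<lambda>_. 0)(0 := n)) M 0 =
      (if k < 0 then 0 else if wtd {..<n} E w \<le> nat \<bar>k\<bar> then 1 else 0)"
    using k by (simp add: decision_cmd_def)
  then show ?thesis by auto
qed

lemma run_decomposition_cmd:
  assumes a: "a = last_such n (centre_like {..<n} E)" and M: "encodes n E w M"
  shows "optimal_decomposition_output (n, E, w) (run decomposition_cmd ((\<lambda>_. 0)(0 := n)) M)"
proof -
  let ?\<rho> = "(\<lambda>_. 0 :: nat)(0 := n)"
  define p where "p = Suc (n + n * n)"
  define t where "t = threshold best"
  \<comment> \<open>\<open>M1\<close> to \<open>M4\<close> are the memories after the four
    successive commands.\<close>
  define M1 where "M1 = (\<lambda>i. if p \<le> i \<and> i < p + n then parent_code t (i - p) else M i)"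
  define M2 where "M2 = M1(p + n := depth t)"
  define M3 where "M3 = (\<lambda>i. if 1 \<le> i \<and> i < 1 + n then M2 (p + (i - 1)) else M2 i)"
  define M4 where "M4 = M3(0 := depth t)"
  have step1: "run (Write (Plus (size_exp 2) (Var 1)) (optimal_exp 2 (parent_exp 5 2 4 1))) (?\<rho>(1 := v)) M' =
      M'(p + v := parent_code t v)" if "v < n" "encodes n E w M'" for v M'
    using that a by (simp add: eval_optimal_exp p_def t_def)
  have step1': "encodes n E w (M'(p + v := y))" if "encodes n E w M'" for v M' y
    using that by (rule encodes_cong) (simp add: p_def)
  note fold1 = fold_write[where m = n and P = "encodes n E w", OF step1 step1' M]
  have M1: "run (For 1 (Write (Plus (size_exp 2) (Var 1)) (optimal_exp 2 (parent_exp 5 2 4 1)))) ?\<rho> M = M1"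
    unfolding run.simps(3) fun_upd_same M1_def by (rule fold1(1))
  have M1': "encodes n E w M1"
    by (rule encodes_cong[OF M]) (simp add: M1_def p_def)
  have M2: "run (Write (Plus (size_exp 1) (Var 0)) (optimal_exp 1 (depth_exp 4 1 3))) ?\<rho> M1 = M2"
    using M1' a by (simp add: eval_optimal_exp M2_def p_def t_def)
  \<comment> \<open>Copying writes to addresses at most n, below \<open>p\<close>, and so never
    disturbs what later rounds read.\<close>
  have step3: "run (Write (Plus (Num 1) (Var 1)) (Mem (Plus (size_exp 2) (Var 1)))) (?\<rho>(1 := v)) M' =
      M'(1 + v := M2 (p + v))" if "v < n" "\<forall>i\<ge>p. M' i = M2 i" for v M'
    using that by (simp add: p_def)
  have step3': "\<forall>i\<ge>p. (M'(1 + v := y)) i = M2 i" if "v < n" "\<forall>i\<ge>p. M' i = M2 i" for v M' and y :: nat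
    using that by (simp add: p_def)
  note fold3 = fold_write[where m = n and P = "\<lambda>M'. \<forall>i\<ge>p. M' i = M2 i", OF step3 step3']
  have M3: "run (For 1 (Write (Plus (Num 1) (Var 1)) (Mem (Plus (size_exp 2) (Var 1))))) ?\<rho> M2 = M3"
    unfolding run.simps(3) fun_upd_same M3_def by (rule fold3(1)) simp_all
  have M4: "run decomposition_cmd ?\<rho> M = M4"
    unfolding decomposition_cmd_def run.simps(2) M1 M2 M3
    by (simp add: M4_def M3_def M2_def p_def)
  define F where "F = decode_forest n M4"
  have F: "F v = (if v < n \<and> parent_code t v \<noteq> 0 then Some (parent_code t v - 1) else None)" for v
    by (auto simp: F_def decode_forest_def M4_def M3_def M2_def M1_def)
  have "fo.parent_map t F"
    unfolding fo.parent_map_def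
  proof (intro conjI allI impI ballI)
    fix v z assume "F v = Some z"
    then have v: "v < n" "parent_code t v = Suc z" by (auto simp: F split: if_splits)
    show "v \<in> {..<n}" using v by simp
    show "z \<in> {..<n}" "fo.covers t z v"
      using parent_code_cases[of t v] v(2) by auto
  next
    fix v z assume "F v = None" "v \<in> {..<n}" "z \<in> {..<n}"
    then have "parent_code t v = 0" "z < n" by (auto simp: F split: if_splits)
    then show "\<not> fo.covers t z v"
      using parent_code_cases[of t v] by auto
  qed
  note dec = decomposition_of_order[OF this]
  have "M4 0 = depth t" by (simp add: M4_def)
  then show ?thesis
    using dec unfolding M4 F_def[symmetric] by (simp add: wtd_eq_depth t_def depth_def F_def)
qed

end

text \<open>The centre given by \<open>subdivided_star\<close> may differ from the one that the
  machine finds, so the graph is read anew with the latter as its centre.\<close>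

lemma star_instance_exists:
  assumes "(n, E, w) \<in> star_instances q"
  shows "\<exists>B c. star_instance n E w (last_such n (centre_like {..<n} E)) B c"
proof -
  have w: "0 < w v" if "v \<in> {..<n}" for v
    using assms that by (force simp: star_instances_def)
  obtain a B c where "subdivided {..<n} E w a B c"
    using subdivided_star_imp_subdivided[of "{..<n}" E w] assms w by (auto simp: star_instances_def)
  then interpret s: subdivided "{..<n}" E w a B c .
  have "last_such n (centre_like {..<n} E) < n" "centre_like {..<n} E (last_such n (centre_like {..<n} E))"
    using last_such[of a n "centre_like {..<n} E"] s.in_V(1) s.centre_like_centre by simp_all
  then obtain B' c' where "subdivided {..<n} E w (last_such n (centre_like {..<n} E)) B' c'"
    using s.centre_like_imp_centre by blast
  then show ?thesis by (auto simp: star_instance_def)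
qed

theorem theorem3:
  shows "(\<exists>P. \<forall>q. solves_in_polytime P (star_instances q \<times> (UNIV :: int set))
                   encode_graph_int weighted_treedepth_output) \<and>
         (\<exists>P. \<forall>q. solves_in_polytime P (star_instances q)
                   encode_graph optimal_decomposition_output)"
proof (intro conjI exI allI)
  fix q
  show "solves_in_polytime (program_of decision_cmd) (star_instances q \<times> UNIV)
      encode_graph_int weighted_treedepth_output"
  proof (rule solves_program_of[OF wf_decision_cmd])
    fix x :: "weighted_graph \<times> int" assume x: "x \<in> star_instances q \<times> UNIV"
    obtain n E w k where x_eq: "x = ((n, E, w), k)" by (metis prod.collapse)
    let ?ys = "[if k < 0 then 1 else 0, nat \<bar>k\<bar>]"
    have enc: "encode_graph_int x = encode_graph (n, E, w) @ ?ys" by (simp add: x_eq)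
    have n: "memory (encode_graph_int x) 0 = n"
      unfolding enc by (subst memory_append) simp_all
    then show "memory (encode_graph_int x) 0 \<le> length (encode_graph_int x)"
      unfolding enc by (simp del: encode_graph.simps)
    obtain B c where "star_instance n E w (last_such n (centre_like {..<n} E)) B c"
      using star_instance_exists x x_eq by blast
    then interpret star_instance n E w "last_such n (centre_like {..<n} E)" B c .
    have k: "memory (encode_graph_int x) (Suc (n + n * n)) = (if k < 0 then 1 else 0)"
      "memory (encode_graph_int x) (Suc (Suc (n + n * n))) = nat \<bar>k\<bar>"
      unfolding enc memory_def by (simp_all add: nth_append del: encode_graph.simps)
    show "weighted_treedepth_output x (run decision_cmd ((\<lambda>_. 0)(0 := memory (encode_graph_int x) 0))
        (memory (encode_graph_int x)))"
      unfolding n unfolding x_eq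
      by (rule run_decision_cmd) (use k encodes_memory enc in \<open>simp_all only: x_eq\<close>)
  qed
next
  fix q
  show "solves_in_polytime (program_of decomposition_cmd) (star_instances q)
      encode_graph optimal_decomposition_output"
  proof (rule solves_program_of[OF wf_decomposition_cmd])
    fix x assume x: "x \<in> star_instances q"
    obtain n E w where x_eq: "x = (n, E, w)" by (metis prod.collapse)
    have n: "memory (encode_graph x) 0 = n"
      unfolding x_eq by (simp add: memory_def)
    then show "memory (encode_graph x) 0 \<le> length (encode_graph x)"
      by (simp add: x_eq del: encode_graph.simps)
    obtain B c where "star_instance n E w (last_such n (centre_like {..<n} E)) B c"
      using star_instance_exists x x_eq by blast
    then interpret star_instance n E w "last_such n (centre_like {..<n} E)" B c .
    show "optimal_decomposition_output x (run decomposition_cmd ((\<lambda>_. 0)(0 := memory (encode_graph x) 0))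
        (memory (encode_graph x)))"
      unfolding n unfolding x_eq
      by (rule run_decomposition_cmd) (use encodes_memory[of n E w "[]"] in simp_all)
  qed
qed

end
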